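(* Let $\theta\in\mathbb{R}$ be irrational. Then the ideal $J:=\langle 1-uu^*,1-vv^*\rangle$ contains all non-trivial ideals of $\mathcal{T}*_\theta\mathcal{T}$, i.e. for every (closed two-sided) ideal $I$ of $\mathcal{T}*_\theta\mathcal{T}$ with $I\neq\mathcal{T}*_\theta\mathcal{T}$ we have $I\subseteq J$.
   Context: Put $\lambda=e^{2\pi i\theta}$. The free twist of two isometries $\mathcal{T}*_\theta\mathcal{T}$ is the universal unital $C^*$-algebra generated by two isometries $u$ and $v$ such that $uv=\lambda vu$. $\langle\cdot\rangle$ denotes the closed two-sided ideal generated by the given elements. *)

theory Defs
  imports "HOL-Analysis.Analysis" "HOL-Algebra.Module" "HOL-Algebra.Subrings"
begin

section \<open>Unital \<open>C\<^sup>*\<close>-algebras with explicit carriers\<close>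

definition complex_ring :: "complex ring" where
  "complex_ring = \<lparr>carrier = UNIV, mult = (*), one = 1, zero = 0, add = (+)\<rparr>"

record 'a cstar = "(complex, 'a) module" +
  adj :: "'a \<Rightarrow> 'a"
  nrm :: "'a \<Rightarrow> real"

text \<open>Outside the carrier the distance is set to 0, because \<^const>\<open>Metric_space\<close> demands
  nonnegativity and symmetry of the distance on the whole type.\<close>

definition cdist :: "'a cstar \<Rightarrow> 'a \<Rightarrow> 'a \<Rightarrow> real" where
  "cdist A x y = (if x \<in> carrier A \<and> y \<in> carrier A then nrm A (x \<ominus>\<^bsub>A\<^esub> y) else 0)"

text \<open>The zero algebra is not excluded. (The locale \<^locale>\<open>algebra\<close> of HOL-Algebra is not used
  since it demands commutativity.)\<close>

locale cstar_algebra = Module.module complex_ring A + ring A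
  for A :: "'a cstar" (structure) +
  assumes smult_mult_left:
      "\<lbrakk>x \<in> carrier A; y \<in> carrier A\<rbrakk> \<Longrightarrow> (c \<odot> x) \<otimes> y = c \<odot> (x \<otimes> y)"
    and smult_mult_right:
      "\<lbrakk>x \<in> carrier A; y \<in> carrier A\<rbrakk> \<Longrightarrow> x \<otimes> (c \<odot> y) = c \<odot> (x \<otimes> y)"
    and adj_closed: "x \<in> carrier A \<Longrightarrow> adj A x \<in> carrier A"
    and adj_adj: "x \<in> carrier A \<Longrightarrow> adj A (adj A x) = x"
    and adj_add:
      "\<lbrakk>x \<in> carrier A; y \<in> carrier A\<rbrakk> \<Longrightarrow> adj A (x \<oplus> y) = adj A x \<oplus> adj A y"
    and adj_smult: "x \<in> carrier A \<Longrightarrow> adj A (c \<odot> x) = cnj c \<odot> adj A x"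
    and adj_mult:
      "\<lbrakk>x \<in> carrier A; y \<in> carrier A\<rbrakk> \<Longrightarrow> adj A (x \<otimes> y) = adj A y \<otimes> adj A x"
    and nrm_nonneg: "x \<in> carrier A \<Longrightarrow> 0 \<le> nrm A x"
    and nrm_eq_zero: "x \<in> carrier A \<Longrightarrow> nrm A x = 0 \<longleftrightarrow> x = \<zero>"
    and nrm_triangle:
      "\<lbrakk>x \<in> carrier A; y \<in> carrier A\<rbrakk> \<Longrightarrow> nrm A (x \<oplus> y) \<le> nrm A x + nrm A y"
    and nrm_smult: "x \<in> carrier A \<Longrightarrow> nrm A (c \<odot> x) = cmod c * nrm A x"
    and nrm_mult:
      "\<lbrakk>x \<in> carrier A; y \<in> carrier A\<rbrakk> \<Longrightarrow> nrm A (x \<otimes> y) \<le> nrm A x * nrm A y"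
    and nrm_cstar: "x \<in> carrier A \<Longrightarrow> nrm A (adj A x \<otimes> x) = (nrm A x)\<^sup>2"
    and complete: "Metric_space.mcomplete (carrier A) (cdist A)"

definition norm_closed :: "'a cstar \<Rightarrow> 'a set \<Rightarrow> bool" where
  "norm_closed A S \<longleftrightarrow> closedin (Metric_space.mtopology (carrier A) (cdist A)) S"

lemma (in cstar_algebra) Metric_space_cdist: "Metric_space (carrier A) (cdist A)"
proof
  have minus_one: "\<ominus> x = (- 1) \<odot> x" if "x \<in> carrier A" for x
  proof -
    have "(- 1) \<odot> x \<oplus> x = (- 1) \<odot> x \<oplus> 1 \<odot> x"
      using that smult_one[of x] by (simp add: complex_ring_def)
    also have "\<dots> = (- 1 + 1) \<odot> x"
      using that smult_l_distr[of "-1" 1 x] by (simp add: complex_ring_def)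
    also have "\<dots> = \<zero>"
      using that nrm_smult[of x 0] nrm_eq_zero[of "0 \<odot> x"] smult_closed[of 0 x]
      by (simp add: complex_ring_def)
    finally show ?thesis
      using that smult_closed[of "-1" x] by (simp add: complex_ring_def M.minus_equality)
  qed
  fix x y
  show "0 \<le> cdist A x y"
    by (simp add: cdist_def nrm_nonneg)
  show "cdist A x y = cdist A y x"
  proof (cases "x \<in> carrier A \<and> y \<in> carrier A")
    case True
    then have "nrm A (y \<ominus> x) = nrm A (\<ominus> (x \<ominus> y))"
      by (simp add: a_minus_def M.minus_add M.a_comm)
    also have "\<dots> = nrm A (x \<ominus> y)"
      using True by (simp add: minus_one nrm_smult)
    finally show ?thesis using True by (simp add: cdist_def)
  qed (auto simp: cdist_def)
next
  fix x y assume "x \<in> carrier A" "y \<in> carrier A"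
  then show "cdist A x y = 0 \<longleftrightarrow> x = y"
    by (simp add: cdist_def nrm_eq_zero)
next
  fix x y z assume xyz: "x \<in> carrier A" "y \<in> carrier A" "z \<in> carrier A"
  then have "x \<ominus> z = (x \<ominus> y) \<oplus> (y \<ominus> z)"
    by (simp add: a_minus_def M.a_assoc M.r_neg1)
  with xyz show "cdist A x z \<le> cdist A x y + cdist A y z"
    using nrm_triangle[of "x \<ominus> y" "y \<ominus> z"] by (simp add: cdist_def)
qed


section \<open>Closed ideals, generated subalgebras, homomorphisms\<close>

definition closed_ideal :: "'a cstar \<Rightarrow> 'a set \<Rightarrow> bool" where
  "closed_ideal A I \<longleftrightarrow> ideal I A \<and> norm_closed A I"

definition closed_ideal_gen :: "'a cstar \<Rightarrow> 'a set \<Rightarrow> 'a set" where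
  "closed_ideal_gen A S = \<Inter>{I. closed_ideal A I \<and> S \<subseteq> I}"

definition cstar_subalgebra :: "'a cstar \<Rightarrow> 'a set \<Rightarrow> bool" where
  "cstar_subalgebra A B \<longleftrightarrow> subring B A \<and> (\<forall>c. \<forall>x\<in>B. c \<odot>\<^bsub>A\<^esub> x \<in> B) \<and>
     (\<forall>x\<in>B. adj A x \<in> B) \<and> norm_closed A B"

definition cstar_gen :: "'a cstar \<Rightarrow> 'a set \<Rightarrow> 'a set" where
  "cstar_gen A S = \<Inter>{B. cstar_subalgebra A B \<and> S \<subseteq> B}"

text \<open>\<^const>\<open>ring_hom\<close> consists of unital homomorphisms.\<close>

definition cstar_hom :: "'a cstar \<Rightarrow> 'b cstar \<Rightarrow> ('a \<Rightarrow> 'b) set" where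
  "cstar_hom A B = {h \<in> ring_hom A B.
     (\<forall>c. \<forall>x\<in>carrier A. h (c \<odot>\<^bsub>A\<^esub> x) = c \<odot>\<^bsub>B\<^esub> h x) \<and>
     (\<forall>x\<in>carrier A. h (adj A x) = adj B (h x))}"

section \<open>The free twist of two isometries\<close>

definition isometry :: "'a cstar \<Rightarrow> 'a \<Rightarrow> bool" where
  "isometry A u \<longleftrightarrow> u \<in> carrier A \<and> adj A u \<otimes>\<^bsub>A\<^esub> u = \<one>\<^bsub>A\<^esub>"

definition twisted_isometries :: "real \<Rightarrow> 'a cstar \<Rightarrow> 'a \<Rightarrow> 'a \<Rightarrow> bool" where
  "twisted_isometries \<theta> A u v \<longleftrightarrow> isometry A u \<and> isometry A v \<and>
     u \<otimes>\<^bsub>A\<^esub> v = exp (2 * complex_of_real pi * \<i> * complex_of_real \<theta>) \<odot>\<^bsub>A\<^esub> (v \<otimes>\<^bsub>A\<^esub> u)"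

text \<open>
  \<open>free_twist \<theta> A u v\<close> says that \<open>A\<close> with the generators \<open>u\<close> and \<open>v\<close> is the universal unital
  \<open>C\<^sup>*\<close>-algebra generated by two isometries with \<open>u v = \<lambda> v u\<close>. The homomorphism to \<open>B\<close> is unique
  on the carrier because \<open>A\<close> is generated by \<open>u\<close> and \<open>v\<close>.

  The test algebras \<open>B\<close> range over all unital \<open>C\<^sup>*\<close>-algebras whose carrier lies in the type of
  the elements of \<open>A\<close>. For nonzero \<open>A\<close> this is no restriction: that type has at least the
  cardinality of the continuum, and a \<open>C\<^sup>*\<close>-algebra generated by two elements has at most that
  cardinality, so an isomorphic copy of it is among the test algebras.
\<close>

definition free_twist :: "real \<Rightarrow> 'a cstar \<Rightarrow> 'a \<Rightarrow> 'a \<Rightarrow> bool" where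
  "free_twist \<theta> A u v \<longleftrightarrow>
     cstar_algebra A \<and> twisted_isometries \<theta> A u v \<and> cstar_gen A {u, v} = carrier A \<and>
     (\<forall>(B :: 'a cstar) U V. cstar_algebra B \<and> twisted_isometries \<theta> B U V \<longrightarrow>
        (\<exists>h \<in> cstar_hom A B. h u = U \<and> h v = V))"

end

(* For a proper closed ideal I, the elements x whose products x u^k v^l tend to 0 modulo I as k and l
   grow form a closed two-sided ideal L. It contains I, and it contains 1 - uu* and 1 - vv* because
   these annihilate u^k v^l for k, l > 0. It is proper because the u^k v^l are isometries. So it is
   enough to show that J is maximal, that is, that the irrational rotation algebra A/J is simple.

   Modulo J the monomials u^k v^l with integer exponents are defined and span a dense subspace.
   Conjugation by u and v multiplies the coefficient at (k, l) by lambda^l and lambda^(-k). As lambda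
   is not a root of unity, averages of iterated conjugations extract single coefficients and apply
   Fejer means, both without increasing the quotient norms of A/J and A/L. If x in L and p is a
   combination of monomials close to x modulo J, then every coefficient of p is small, as p is small
   modulo L and monomials are invertible modulo L. Hence the Fejer means of p are small, while those
   of high order are close to x modulo J. This forces x in J. *)

theory Submission
  imports Defs
begin

section \<open>Averages of characters and Fejer means\<close>

text \<open>Averaging over the gauge action of the torus would also isolate coefficients, but
  nothing says beforehand that a gauge automorphism preserves L. Conjugations by \<open>u\<close>
  and \<open>v\<close> preserve every ideal, and since lambda has infinite order, averages over
  their powers replace integrals over the torus. No limit of averages is taken in the algebra: over
  a finite index set a quotient seminorm is a seminorm on finitely many coefficients, where
  coefficientwise convergence is enough.

  The order of choices shapes the last estimate. A coarse approximation of x fixes the order of the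
  Fejer mean; the order fixes the finitely many indices that carry weight; only then is a finer
  approximation chosen, so good that the coefficients at these indices are negligible together. The
  two Fejer means stay close because the means are contractive with constant 1 for every
  order.\<close>

lemma geometric_average_tendsto_0:
  fixes z :: complex
  assumes "cmod z = 1" "z \<noteq> 1"
  shows "(\<lambda>M. (\<Sum>j<M. z ^ j) / of_nat M) \<longlonglongrightarrow> 0"
proof (rule Lim_null_comparison)
  show "\<forall>\<^sub>F M in sequentially. norm ((\<Sum>j<M. z ^ j) / of_nat M) \<le> (2 / cmod (z - 1)) / of_nat M"
  proof (intro always_eventually allI)
    fix M
    have "cmod (z ^ M - 1) \<le> 2"
      using norm_triangle_ineq4[of "z ^ M" 1] assms by (simp add: norm_power)
    then have "norm (\<Sum>j<M. z ^ j) \<le> 2 / cmod (z - 1)"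
      using assms by (simp add: geometric_sum norm_divide divide_right_mono)
    from divide_right_mono[OF this, of "real M"]
    show "norm ((\<Sum>j<M. z ^ j) / of_nat M) \<le> (2 / cmod (z - 1)) / of_nat M"
      by (simp add: norm_divide)
  qed
  show "(\<lambda>M. 2 / cmod (z - 1) / real M) \<longlonglongrightarrow> 0"
    by (rule lim_const_over_n)
qed

text \<open>Weyl equidistribution: along the orbit of a rotation of infinite order, the mean of a
  character tends to its integral over the circle.\<close>

lemma character_average_tendsto:
  fixes z :: complex
  assumes "cmod z = 1" and "\<And>n :: int. z powi n = 1 \<Longrightarrow> n = 0"
  shows "(\<lambda>M. (\<Sum>j<M. (z powi n) ^ j) / of_nat M) \<longlonglongrightarrow> of_bool (n = 0)"
proof (cases "n = 0")
  case True
  have "\<forall>\<^sub>F M in sequentially. (\<Sum>j<M. (z powi n) ^ j) / of_nat M = (1 :: complex)"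
    using eventually_gt_at_top[of 0] by eventually_elim (simp add: True)
  then show ?thesis
    using True by (simp add: tendsto_eventually)
next
  case False
  then show ?thesis
    using assms geometric_average_tendsto_0[of "z powi n"] by (auto simp: norm_power_int)
qed

text \<open>\<open>fejer N m\<close> is the \<open>m\<close>-th Fourier coefficient of the nonnegative function \<open>\<bar>\<Sum>n<N. z ^ n\<bar>\<^sup>2 / N\<close>
  on the circle.\<close>

definition fejer :: "nat \<Rightarrow> int \<Rightarrow> real" where
  "fejer N m = (\<Sum>n<N. \<Sum>n'<N. of_bool (int n - int n' + m = 0)) / N"

lemma fejer_eq_0: "int N \<le> \<bar>m\<bar> \<Longrightarrow> fejer N m = 0"
  unfolding fejer_def by (auto intro!: sum.neutral)

text \<open>The double sum counts the \<open>n < N\<close> for which \<open>n + m\<close> lies in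
  the same range; there are N - |m| of them when |m| \<le> N.\<close>

lemma fejer_bounds:
  assumes "N > 0"
  shows "1 - real_of_int \<bar>m\<bar> / real N \<le> fejer N m" "fejer N m \<le> 1"
proof -
  have row: "(\<Sum>n'<N. of_bool (int n - int n' + m = 0)) = (of_bool (0 \<le> int n + m \<and> int n + m < int N) :: real)"
    for n
  proof -
    have "(\<Sum>n'<N. of_bool (int n - int n' + m = 0)) =
        (\<Sum>n'<N. if n' = nat (int n + m) then of_bool (0 \<le> int n + m) else (0 :: real))"
      by (intro sum.cong) auto
    also have "\<dots> = of_bool (0 \<le> int n + m \<and> int n + m < int N)"
      by (subst sum.delta) auto
    finally show ?thesis .
  qed
  have f: "fejer N m = card {n. n < N \<and> 0 \<le> int n + m \<and> int n + m < int N} / N"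
    unfolding fejer_def row by (simp add: sum_of_bool_eq Int_def)
  have "card {n. n < N \<and> 0 \<le> int n + m \<and> int n + m < int N} \<le> card {..<N}"
    by (intro card_mono) auto
  with f assms show "fejer N m \<le> 1" by simp
  have "card {nat (- m)..<N - nat m} \<le> card {n. n < N \<and> 0 \<le> int n + m \<and> int n + m < int N}"
    by (intro card_mono) auto
  moreover have "int N - \<bar>m\<bar> \<le> int (card {nat (- m)..<N - nat m})"
    by simp
  ultimately have "real N - real_of_int \<bar>m\<bar> \<le> card {n. n < N \<and> 0 \<le> int n + m \<and> int n + m < int N}"
    by linarith
  then have "(real N - real_of_int \<bar>m\<bar>) / N \<le> fejer N m"
    unfolding f by (intro divide_right_mono) auto
  then show "1 - real_of_int \<bar>m\<bar> / real N \<le> fejer N m"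
    using assms by (simp add: diff_divide_distrib)
qed

lemma fejer_0: "N > 0 \<Longrightarrow> fejer N 0 = 1"
  using fejer_bounds[of N 0] by simp

lemma fejer_tendsto_1: "(\<lambda>N. fejer N m) \<longlonglongrightarrow> 1"
proof (rule tendsto_sandwich)
  show "\<forall>\<^sub>F N in sequentially. 1 - real_of_int \<bar>m\<bar> / real N \<le> fejer N m"
    using eventually_gt_at_top[of 0] by eventually_elim (rule fejer_bounds)
  show "\<forall>\<^sub>F N in sequentially. fejer N m \<le> 1"
    using eventually_gt_at_top[of 0] by eventually_elim (rule fejer_bounds)
  have "(\<lambda>N. 1 - real_of_int \<bar>m\<bar> / real N) \<longlonglongrightarrow> 1 - 0"
    by (intro tendsto_diff tendsto_const lim_const_over_n)
  then show "(\<lambda>N. 1 - real_of_int \<bar>m\<bar> / real N) \<longlonglongrightarrow> 1" by simp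
qed simp

text \<open>Expanding the square turns kernel times character into a finite double sum of
  characters; averaging keeps the terms of exponent 0, and these are what \<open>fejer\<close>
  counts.\<close>

lemma fejer_kernel_average_tendsto:
  fixes z :: complex
  assumes z: "cmod z = 1" and "\<And>n :: int. z powi n = 1 \<Longrightarrow> n = 0"
  shows "(\<lambda>M. (\<Sum>j<M. of_real ((cmod (\<Sum>n<N. (z ^ j) ^ n))\<^sup>2 / N) * (z powi m) ^ j) / of_nat M)
    \<longlonglongrightarrow> of_real (fejer N m)"
proof -
  have z0: "z \<noteq> 0" and cz: "cnj z = inverse z"
    using z by (auto simp: complex_eq_iff inverse_complex_def cmod_def)
  have kernel: "of_real ((cmod (\<Sum>n<N. (z ^ j) ^ n))\<^sup>2 / N) * (z powi m) ^ j =
      (\<Sum>n<N. \<Sum>n'<N. (z powi (int n - int n' + m)) ^ j) / N" for j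
  proof -
    have "(z ^ j) ^ n * cnj ((z ^ j) ^ n') * (z powi m) ^ j = (z powi (int n - int n' + m)) ^ j"
      for n n'
      using z0
      by (simp add: cz power_int_add power_int_diff power_mult_distrib power_divide field_simps
          flip: power_mult)
    then have "(\<Sum>n<N. (z ^ j) ^ n) * cnj (\<Sum>n<N. (z ^ j) ^ n) * (z powi m) ^ j =
      (\<Sum>n<N. \<Sum>n'<N. (z powi (int n - int n' + m)) ^ j)"
      unfolding cnj_sum sum_product by (simp only: sum_distrib_right)
    then show ?thesis
      by (simp only: of_real_divide complex_norm_square of_real_of_nat_eq times_divide_eq_left)
  qed
  have "(\<lambda>M. (\<Sum>n<N. \<Sum>n'<N. (\<Sum>j<M. (z powi (int n - int n' + m)) ^ j) / of_nat M) / N)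
      \<longlonglongrightarrow> (\<Sum>n<N. \<Sum>n'<N. of_bool (int n - int n' + m = 0)) / of_nat N"
    by (cases "N = 0")
      (simp, intro tendsto_sum tendsto_divide tendsto_const character_average_tendsto assms, simp_all)
  moreover have "(\<Sum>j<M. (\<Sum>n<N. \<Sum>n'<N. (z powi (int n - int n' + m)) ^ j) / of_nat N) / of_nat M =
      (\<Sum>n<N. \<Sum>n'<N. (\<Sum>j<M. (z powi (int n - int n' + m)) ^ j) / of_nat M) / of_nat N" for M
  proof -
    have "(\<Sum>j<M. \<Sum>n<N. \<Sum>n'<N. (z powi (int n - int n' + m)) ^ j) =
      (\<Sum>n<N. \<Sum>n'<N. \<Sum>j<M. (z powi (int n - int n' + m)) ^ j)"
      by (rule trans[OF sum.swap]) (intro sum.cong refl sum.swap)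
    then show ?thesis
      by (simp flip: sum_divide_distrib)
  qed
  ultimately show ?thesis
    unfolding kernel fejer_def by simp
qed

section \<open>Seminorms on finitely many complex coefficients\<close>

locale finitary_seminorm =
  fixes Q :: "('i \<Rightarrow> complex) \<Rightarrow> real" and F :: "'i set"
  assumes finite_support: "finite F"
    and Q_cong: "\<And>c d. (\<And>i. i \<in> F \<Longrightarrow> c i = d i) \<Longrightarrow> Q c = Q d"
    and Q_nonneg: "\<And>c. 0 \<le> Q c"
    and Q_add: "\<And>c d. Q (\<lambda>i. c i + d i) \<le> Q c + Q d"
    and Q_scale: "\<And>a c. Q (\<lambda>i. a * c i) \<le> cmod a * Q c"
begin

lemma Q_zero: "Q (\<lambda>i. 0) = 0"
  using Q_scale[of 0 "\<lambda>i. 0"] Q_nonneg[of "\<lambda>i. 0"] by simp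

lemma Q_sum: "finite S \<Longrightarrow> Q (\<lambda>i. \<Sum>s\<in>S. a s * c s i) \<le> (\<Sum>s\<in>S. cmod (a s) * Q (c s))"
proof (induction S rule: finite_induct)
  case empty
  then show ?case by (simp add: Q_zero)
next
  case (insert x S)
  then show ?case
    using Q_add[of "\<lambda>i. a x * c x i" "\<lambda>i. \<Sum>s\<in>S. a s * c s i"] Q_scale[of "a x" "c x"] by simp
qed

lemma Q_le_sum: "Q c \<le> (\<Sum>i\<in>F. cmod (c i) * Q (\<lambda>j. of_bool (j = i)))"
proof -
  have "Q c = Q (\<lambda>j. \<Sum>i\<in>F. c i * of_bool (j = i))"
  proof (rule Q_cong)
    fix j assume "j \<in> F"
    then show "c j = (\<Sum>i\<in>F. c i * of_bool (j = i))"
      using finite_support sum.delta'[of F j c] by (simp add: of_bool_def if_distrib cong: if_cong)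
  qed
  also have "\<dots> \<le> (\<Sum>i\<in>F. cmod (c i) * Q (\<lambda>j. of_bool (j = i)))"
    by (rule Q_sum) (rule finite_support)
  finally show ?thesis .
qed

text \<open>By \<open>Q_le_sum\<close> such a seminorm is dominated by a weighted sum of moduli of
  coefficients, hence continuous under coefficientwise convergence.\<close>

lemma Q_le_lim:
  assumes c: "\<And>i. i \<in> F \<Longrightarrow> (\<lambda>M. cs M i) \<longlonglongrightarrow> c i"
    and B: "\<And>M. Q (cs M) \<le> B M" "B \<longlonglongrightarrow> b"
  shows "Q c \<le> b"
proof -
  have "Q c \<le> B M + (\<Sum>i\<in>F. cmod (c i - cs M i) * Q (\<lambda>j. of_bool (j = i)))" for M
    using Q_add[of "cs M" "\<lambda>i. c i - cs M i"] Q_le_sum[of "\<lambda>i. c i - cs M i"] B(1)[of M]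
    by simp
  moreover have "(\<lambda>M. B M + (\<Sum>i\<in>F. cmod (c i - cs M i) * Q (\<lambda>j. of_bool (j = i))))
      \<longlonglongrightarrow> b + (\<Sum>i\<in>F. cmod (c i - c i) * Q (\<lambda>j. of_bool (j = i)))"
    by (intro tendsto_add B(2) tendsto_sum tendsto_mult tendsto_norm tendsto_diff tendsto_const c)
  ultimately show ?thesis
    by (intro LIMSEQ_le_const) auto
qed

context
  fixes \<zeta> :: complex and f :: "'i \<Rightarrow> int"
  assumes rot: "\<And>c. Q (\<lambda>i. \<zeta> powi f i * c i) \<le> Q c"
    and norm_\<zeta>: "cmod \<zeta> = 1"
    and not_root_of_unity: "\<And>n :: int. \<zeta> powi n = 1 \<Longrightarrow> n = 0"
begin

lemma Q_rot_pow: "Q (\<lambda>i. (\<zeta> powi f i) ^ j * c i) \<le> Q c"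
proof (induction j)
  case (Suc j)
  then show ?case
    using rot[of "\<lambda>i. (\<zeta> powi f i) ^ j * c i"] by (simp add: mult.assoc)
qed simp

text \<open>Every rotated family has seminorm at most \<open>Q c\<close>, so the average with
  weights \<open>a\<close> has at most the mean of the moduli of \<open>a\<close> times
  \<open>Q c\<close>. In the limit the average acts as the multiplier \<open>\<phi>\<close>.\<close>

lemma Q_average:
  assumes a: "(\<lambda>M. (\<Sum>j<M. cmod (a j)) / of_nat M) \<longlonglongrightarrow> 1"
    and \<phi>: "\<And>n. (\<lambda>M. (\<Sum>j<M. a j * (\<zeta> powi n) ^ j) / of_nat M) \<longlonglongrightarrow> \<phi> n"
  shows "Q (\<lambda>i. \<phi> (f i) * c i) \<le> Q c"
proof -
  define cs where "cs M i = (\<Sum>j<M. a j / of_nat M * ((\<zeta> powi f i) ^ j * c i))" for M i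
  show ?thesis
  proof (rule Q_le_lim)
    fix i
    have "(\<lambda>M. (\<Sum>j<M. a j * (\<zeta> powi f i) ^ j) / of_nat M * c i) \<longlonglongrightarrow> \<phi> (f i) * c i"
      by (intro tendsto_mult \<phi> tendsto_const)
    moreover have "cs M i = (\<Sum>j<M. a j * (\<zeta> powi f i) ^ j) / of_nat M * c i" for M
      unfolding cs_def sum_divide_distrib sum_distrib_right by (intro sum.cong) auto
    ultimately show "(\<lambda>M. cs M i) \<longlonglongrightarrow> \<phi> (f i) * c i"
      by simp
  next
    fix M
    have "Q (cs M) \<le> (\<Sum>j<M. cmod (a j / of_nat M) * Q (\<lambda>i. (\<zeta> powi f i) ^ j * c i))"
      unfolding cs_def by (rule Q_sum) simp
    also have "\<dots> \<le> (\<Sum>j<M. cmod (a j / of_nat M) * Q c)"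
      by (intro sum_mono mult_left_mono Q_rot_pow) simp
    finally show "Q (cs M) \<le> (\<Sum>j<M. cmod (a j)) / of_nat M * Q c"
      by (simp add: sum_distrib_right sum_divide_distrib norm_divide)
  next
    show "(\<lambda>M. (\<Sum>j<M. cmod (a j)) / real M * Q c) \<longlonglongrightarrow> Q c"
      using tendsto_mult[OF a tendsto_const[of "Q c"]] by simp
  qed
qed

text \<open>The weights are unimodular and shift the character of exponent \<open>n\<close> to the
  trivial one, which alone survives averaging.\<close>

lemma Q_coefficient: "Q (\<lambda>i. of_bool (f i = n) * c i) \<le> Q c"
proof (rule Q_average[where \<phi> = "\<lambda>m. of_bool (m = n)"])
  show "(\<lambda>M. (\<Sum>j<M. cmod ((\<zeta> powi (- n)) ^ j)) / of_nat M) \<longlonglongrightarrow> 1"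
  proof (rule tendsto_eventually)
    show "\<forall>\<^sub>F M in sequentially. (\<Sum>j<M. cmod ((\<zeta> powi (- n)) ^ j)) / of_nat M = 1"
      using eventually_gt_at_top[of 0]
      by eventually_elim (simp add: norm_power norm_power_int norm_\<zeta>)
  qed
  have [simp]: "\<zeta> \<noteq> 0" using norm_\<zeta> by auto
  fix m
  have "(\<zeta> powi (- n)) ^ j * (\<zeta> powi m) ^ j = (\<zeta> powi (m - n)) ^ j" for j
    by (simp add: power_int_diff power_int_minus power_divide field_simps)
  then show "(\<lambda>M. (\<Sum>j<M. (\<zeta> powi (- n)) ^ j * (\<zeta> powi m) ^ j) / of_nat M) \<longlonglongrightarrow> of_bool (m = n)"
    using character_average_tendsto[OF norm_\<zeta> not_root_of_unity, of "m - n"] by simp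
qed

text \<open>The Fejer kernel is nonnegative, so the moduli of the weights have the same mean as the
  weights, and its limit is the zeroth coefficient \<open>fejer N 0 = 1\<close>. This is what makes
  the constant 1.\<close>

lemma Q_fejer:
  assumes "N > 0"
  shows "Q (\<lambda>i. of_real (fejer N (f i)) * c i) \<le> Q c"
proof (rule Q_average[where \<phi> = "\<lambda>m. of_real (fejer N m)"])
  note * = fejer_kernel_average_tendsto[OF norm_\<zeta> not_root_of_unity]
  show "(\<lambda>M. (\<Sum>j<M. of_real ((cmod (\<Sum>n<N. (\<zeta> ^ j) ^ n))\<^sup>2 / N) * (\<zeta> powi m) ^ j) / of_nat M)
      \<longlonglongrightarrow> complex_of_real (fejer N m)" for m
    by (rule *)
  have "(\<lambda>M. Re ((\<Sum>j<M. of_real ((cmod (\<Sum>n<N. (\<zeta> ^ j) ^ n))\<^sup>2 / N) * (\<zeta> powi 0) ^ j) / of_nat M))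
      \<longlonglongrightarrow> Re (of_real (fejer N 0))"
    by (intro tendsto_Re *)
  then show "(\<lambda>M. (\<Sum>j<M. cmod (of_real ((cmod (\<Sum>n<N. (\<zeta> ^ j) ^ n))\<^sup>2 / N))) / of_nat M) \<longlonglongrightarrow> 1"
    using assms by (simp add: fejer_0 Re_divide_of_nat norm_divide norm_power del: of_real_divide of_real_power)
qed

end

end

section \<open>Quotient seminorms\<close>

context cstar_algebra
begin

text \<open>The module axioms speak of the operations of \<open>complex_ring\<close>; here they are
  in plain complex arithmetic.\<close>

lemma scal_closed [simp, intro]: "x \<in> carrier A \<Longrightarrow> c \<odot> x \<in> carrier A"
  and scal_add_left: "x \<in> carrier A \<Longrightarrow> (a + b) \<odot> x = a \<odot> x \<oplus> b \<odot> x"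
  and scal_add_right: "x \<in> carrier A \<Longrightarrow> y \<in> carrier A \<Longrightarrow> c \<odot> (x \<oplus> y) = c \<odot> x \<oplus> c \<odot> y"
  and scal_scal: "x \<in> carrier A \<Longrightarrow> a \<odot> (b \<odot> x) = (a * b) \<odot> x"
  and scal_one: "x \<in> carrier A \<Longrightarrow> 1 \<odot> x = x"
  and scal_zero: "x \<in> carrier A \<Longrightarrow> 0 \<odot> x = \<zero>"
  using smult_closed[of c x] smult_l_distr[of a b x] smult_r_distr[of c x y]
    smult_assoc1[of a b x] smult_one[of x] smult_l_null[of x]
  by (simp_all add: complex_ring_def)

lemma scal_uminus_one: "x \<in> carrier A \<Longrightarrow> (- 1) \<odot> x = \<ominus> x"
  using scal_add_left[of x "-1" 1]
  by (simp add: scal_one scal_zero M.minus_equality)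

lemma scal_zero_right: "c \<odot> \<zero> = \<zero>"
  using smult_r_null[of c] by (simp add: complex_ring_def)

lemma diff_add_cancel: "x \<in> carrier A \<Longrightarrow> y \<in> carrier A \<Longrightarrow> (x \<ominus> y) \<oplus> y = x"
  by (simp add: a_minus_def M.a_assoc M.l_neg)

lemma scal_diff_right:
  "x \<in> carrier A \<Longrightarrow> y \<in> carrier A \<Longrightarrow> c \<odot> (x \<ominus> y) = c \<odot> x \<ominus> c \<odot> y"
  by (simp add: a_minus_def scal_add_right scal_scal flip: scal_uminus_one)

lemma minus_minus_swap: "x \<in> carrier A \<Longrightarrow> y \<in> carrier A \<Longrightarrow> \<ominus> (x \<ominus> y) = y \<ominus> x"
  by (simp add: a_minus_def M.minus_add M.a_comm)

lemma minus_self: "x \<in> carrier A \<Longrightarrow> x \<ominus> x = \<zero>"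
  by (simp add: a_minus_def M.r_neg)

lemma diff_add_diff:
  "x \<in> carrier A \<Longrightarrow> y \<in> carrier A \<Longrightarrow> z \<in> carrier A \<Longrightarrow> (x \<ominus> y) \<oplus> (y \<ominus> z) = x \<ominus> z"
  by (simp add: a_minus_def M.a_assoc M.r_neg1)

lemma add_diff_add:
  "x \<in> carrier A \<Longrightarrow> y \<in> carrier A \<Longrightarrow> x' \<in> carrier A \<Longrightarrow> y' \<in> carrier A \<Longrightarrow>
    (x \<oplus> y) \<ominus> (x' \<oplus> y') = (x \<ominus> x') \<oplus> (y \<ominus> y')"
  by (simp add: a_minus_def M.minus_add M.a_ac)

lemma mult_diff_left:
  "x \<in> carrier A \<Longrightarrow> y \<in> carrier A \<Longrightarrow> z \<in> carrier A \<Longrightarrow> x \<otimes> (y \<ominus> z) = x \<otimes> y \<ominus> x \<otimes> z"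
  by (simp add: a_minus_def r_distr r_minus)

lemma mult_diff_right:
  "x \<in> carrier A \<Longrightarrow> y \<in> carrier A \<Longrightarrow> z \<in> carrier A \<Longrightarrow> (y \<ominus> z) \<otimes> x = y \<otimes> x \<ominus> z \<otimes> x"
  by (simp add: a_minus_def l_distr l_minus)

lemma nrm_zero: "nrm A \<zero> = 0"
  by (simp add: nrm_eq_zero)

lemma nrm_adj: assumes "x \<in> carrier A" shows "nrm A (adj A x) = nrm A x"
proof -
  have le: "nrm A x \<le> nrm A (adj A x)" if x: "x \<in> carrier A" for x
  proof (cases "nrm A x = 0")
    case False
    have "nrm A x * nrm A x \<le> nrm A (adj A x) * nrm A x"
      using nrm_cstar[OF x] nrm_mult[of "adj A x" x] x by (simp add: adj_closed power2_eq_square)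
    then show ?thesis
      using False nrm_nonneg[OF x] by simp
  qed (simp add: nrm_nonneg adj_closed x)
  show ?thesis
    using le[of x] le[of "adj A x"] assms by (simp add: adj_closed adj_adj)
qed

lemma adj_one: "adj A \<one> = \<one>"
  using adj_mult[of "adj A \<one>" \<one>] by (simp add: adj_closed adj_adj)

text \<open>Not an equality, because in the zero algebra the unit has norm 0.\<close>

lemma nrm_one_le: "nrm A \<one> \<le> 1"
proof -
  have "nrm A \<one> * nrm A \<one> = nrm A \<one>"
    using nrm_cstar[of \<one>] by (simp add: adj_one power2_eq_square)
  then show ?thesis
    by (cases "nrm A \<one> = 0") auto
qed

lemma nrm_isometry_le: "isometry A x \<Longrightarrow> nrm A x \<le> 1"
  using nrm_cstar[of x] nrm_one_le nrm_nonneg[of x] power2_le_imp_le[of "nrm A x" 1]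
  by (simp add: isometry_def)

lemma norm_closed_iff:
  "norm_closed A S \<longleftrightarrow>
    S \<subseteq> carrier A \<and> (\<forall>x\<in>carrier A. (\<forall>e>0. \<exists>y\<in>S. nrm A (x \<ominus> y) < e) \<longrightarrow> x \<in> S)"
proof -
  interpret Metric_space "carrier A" "cdist A"
    by (rule Metric_space_cdist)
  have "disjnt S (mball x r) \<longleftrightarrow> (\<forall>y\<in>S. r \<le> nrm A (x \<ominus> y))"
    if "S \<subseteq> carrier A" "x \<in> carrier A" for x r
    using that by (auto simp: disjnt_iff cdist_def subset_iff not_less)
  then show ?thesis
    unfolding norm_closed_def closedin_metric
    by (auto simp: not_less) (meson not_less)+
qed

lemma adj_diff: "x \<in> carrier A \<Longrightarrow> y \<in> carrier A \<Longrightarrow> adj A (x \<ominus> y) = adj A x \<ominus> adj A y"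
  by (simp add: a_minus_def adj_add adj_smult adj_closed flip: scal_uminus_one)

lemma isometry_mult: "isometry A x \<Longrightarrow> isometry A y \<Longrightarrow> isometry A (x \<otimes> y)"
proof -
  assume xy: "isometry A x" "isometry A y"
  then have c: "x \<in> carrier A" "y \<in> carrier A" "adj A x \<in> carrier A" "adj A y \<in> carrier A"
    by (auto simp: isometry_def adj_closed)
  then have "(adj A y \<otimes> adj A x) \<otimes> (x \<otimes> y) = adj A y \<otimes> ((adj A x \<otimes> x) \<otimes> y)"
    by (simp add: m_assoc)
  then show ?thesis
    using xy c by (simp add: isometry_def adj_mult)
qed

lemma isometry_pow: "isometry A x \<Longrightarrow> isometry A (x [^] (n :: nat))"
  by (induction n) (auto simp: isometry_mult, simp add: isometry_def adj_one)

lemma norm_closed_preimage: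
  assumes D: "norm_closed A D" and B: "\<And>x. x \<in> carrier A \<Longrightarrow> T x \<in> carrier A"
    and le: "\<And>x y. x \<in> carrier A \<Longrightarrow> y \<in> carrier A \<Longrightarrow> nrm A (T x \<ominus> T y) \<le> C * nrm A (x \<ominus> y)"
  shows "norm_closed A {x \<in> carrier A. T x \<in> D}"
  unfolding norm_closed_iff
proof (intro conjI ballI impI)
  fix x assume x: "x \<in> carrier A" and lim: "\<forall>e>0. \<exists>y\<in>{x \<in> carrier A. T x \<in> D}. nrm A (x \<ominus> y) < e"
  have "\<exists>y\<in>D. nrm A (T x \<ominus> y) < e" if e: "e > 0" for e
  proof -
    \<comment> \<open>\<open>C\<close> may be 0 or negative, so \<open>\<bar>C\<bar> + 1\<close>
      serves as a positive divisor.\<close>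
    obtain y where y: "y \<in> carrier A" "T y \<in> D" "nrm A (x \<ominus> y) < e / (\<bar>C\<bar> + 1)"
      using lim e by (auto dest: spec[of _ "e / (\<bar>C\<bar> + 1)"])
    have "nrm A (T x \<ominus> T y) \<le> \<bar>C\<bar> * nrm A (x \<ominus> y)"
      using order_trans[OF le[of x y] mult_right_mono[OF abs_ge_self nrm_nonneg]] x y by simp
    also have "\<dots> \<le> \<bar>C\<bar> * (e / (\<bar>C\<bar> + 1))"
      using y by (intro mult_left_mono) auto
    also have "\<dots> < e"
      using e by (simp add: field_simps)
    finally show ?thesis using y by auto
  qed
  then show "x \<in> {x \<in> carrier A. T x \<in> D}"
    using D x B unfolding norm_closed_iff by blast
qed auto

lemma norm_closed_Inter:
  assumes "\<And>S. S \<in> F \<Longrightarrow> norm_closed A S" "F \<noteq> {}"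
  shows "norm_closed A (\<Inter>F)"
  using assms unfolding norm_closed_def by (intro closedin_Inter) auto

lemma norm_closed_carrier: "norm_closed A (carrier A)"
  by (simp add: norm_closed_iff)

lemma closed_ideal_gen:
  assumes "S \<subseteq> carrier A"
  shows "closed_ideal A (closed_ideal_gen A S)" "S \<subseteq> closed_ideal_gen A S"
proof -
  let ?F = "{I. closed_ideal A I \<and> S \<subseteq> I}"
  have "?F \<noteq> {}"
    using assms by (auto simp: closed_ideal_def norm_closed_carrier intro!: exI[of _ "carrier A"] oneideal)
  then show "closed_ideal A (closed_ideal_gen A S)"
    unfolding closed_ideal_gen_def closed_ideal_def
    by (intro conjI i_Intersect norm_closed_Inter) (auto simp: closed_ideal_def)
qed (auto simp: closed_ideal_gen_def)

text \<open>Quotients are handled through representatives: congruence here, the norm of the coset in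
  \<open>qnrm\<close>. Seminorms modulo different ideals thus live on the same elements and can be
  compared, as in \<open>qnrm_antimono\<close>.\<close>

definition cgr :: "'a set \<Rightarrow> 'a \<Rightarrow> 'a \<Rightarrow> bool" where
  "cgr I x y \<longleftrightarrow> x \<in> carrier A \<and> y \<in> carrier A \<and> x \<ominus> y \<in> I"

definition qnrm :: "'a set \<Rightarrow> 'a \<Rightarrow> real" where
  "qnrm I x = (INF i\<in>I. nrm A (x \<ominus> i))"

lemma cgr_carrier: "cgr I x y \<Longrightarrow> x \<in> carrier A" "cgr I x y \<Longrightarrow> y \<in> carrier A"
  by (auto simp: cgr_def)

context
  fixes I assumes ideal: "ideal I A"
begin

interpretation I: ideal I A by (rule ideal)

lemma zero_in_ideal: "\<zero> \<in> I"
  by (rule additive_subgroup.zero_closed) (rule I.is_additive_subgroup)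

lemma ideal_nonempty: "I \<noteq> {}"
  using zero_in_ideal by blast

text \<open>\<open>ideal\<close> is the ring notion; scalars are recovered as multiplication by
  \<open>c \<odot> \<one>\<close>.\<close>

lemma ideal_scal: assumes "x \<in> I" shows "c \<odot> x \<in> I"
proof -
  have x: "x \<in> carrier A" using assms by (rule I.a_Hcarr)
  then have "c \<odot> x = (c \<odot> \<one>) \<otimes> x"
    by (simp add: smult_mult_left)
  then show ?thesis
    using I.I_l_closed[OF assms, of "c \<odot> \<one>"] by simp
qed

lemma cgr_refl: "x \<in> carrier A \<Longrightarrow> cgr I x x"
  by (simp add: cgr_def minus_self zero_in_ideal)

lemma cgr_sym: assumes "cgr I x y" shows "cgr I y x"
  using assms I.a_inv_closed[of "x \<ominus> y"] by (simp add: cgr_def minus_minus_swap)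

lemma cgr_trans: assumes "cgr I x y" "cgr I y z" shows "cgr I x z"
  using assms I.a_closed[of "x \<ominus> y" "y \<ominus> z"] by (simp add: cgr_def diff_add_diff)

lemma cgr_add: assumes "cgr I x x'" "cgr I y y'" shows "cgr I (x \<oplus> y) (x' \<oplus> y')"
  using assms I.a_closed[of "x \<ominus> x'" "y \<ominus> y'"] by (simp add: cgr_def add_diff_add)

lemma cgr_scal: assumes "cgr I x y" shows "cgr I (c \<odot> x) (c \<odot> y)"
  using assms ideal_scal[of "x \<ominus> y" c] by (simp add: cgr_def scal_diff_right)

lemma cgr_mult_left: assumes "cgr I x y" "z \<in> carrier A" shows "cgr I (z \<otimes> x) (z \<otimes> y)"
  using assms I.I_l_closed[of "x \<ominus> y" z] by (simp add: cgr_def mult_diff_left)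

lemma cgr_mult_right: assumes "cgr I x y" "z \<in> carrier A" shows "cgr I (x \<otimes> z) (y \<otimes> z)"
  using assms I.I_r_closed[of "x \<ominus> y" z] by (simp add: cgr_def mult_diff_right)

lemma qnrm_le: "x \<in> carrier A \<Longrightarrow> i \<in> I \<Longrightarrow> qnrm I x \<le> nrm A (x \<ominus> i)"
  unfolding qnrm_def by (intro cINF_lower bdd_belowI2[where m = 0] nrm_nonneg) (auto simp: I.a_Hcarr)

lemma qnrm_less:
  assumes "x \<in> carrier A" "qnrm I x < r"
  obtains i where "i \<in> I" "nrm A (x \<ominus> i) < r"
proof -
  have "bdd_below ((\<lambda>i. nrm A (x \<ominus> i)) ` I)" "I \<noteq> {}"
    using ideal_nonempty assms by (auto intro!: bdd_belowI2[where m = 0] nrm_nonneg simp: I.a_Hcarr)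
  then show ?thesis
    using that assms(2) unfolding qnrm_def by (subst (asm) cINF_less_iff) auto
qed

lemma qnrm_nonneg: "x \<in> carrier A \<Longrightarrow> 0 \<le> qnrm I x"
  unfolding qnrm_def using ideal_nonempty by (intro cINF_greatest nrm_nonneg) (auto simp: I.a_Hcarr)

lemma qnrm_le_nrm: "x \<in> carrier A \<Longrightarrow> qnrm I x \<le> nrm A x"
  using qnrm_le[of x \<zero>] zero_in_ideal by (simp add: a_minus_def)

lemma qnrm_zero: "qnrm I \<zero> = 0"
  using qnrm_nonneg[of \<zero>] qnrm_le_nrm[of \<zero>] by (simp add: nrm_zero)

lemma qnrm_add:
  assumes x: "x \<in> carrier A" and y: "y \<in> carrier A"
  shows "qnrm I (x \<oplus> y) \<le> qnrm I x + qnrm I y"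
proof (rule field_le_epsilon)
  fix e :: real assume e: "0 < e"
  obtain i where i: "i \<in> I" "nrm A (x \<ominus> i) < qnrm I x + e / 2"
    using qnrm_less[OF x, of "qnrm I x + e / 2"] e by auto
  obtain j where j: "j \<in> I" "nrm A (y \<ominus> j) < qnrm I y + e / 2"
    using qnrm_less[OF y, of "qnrm I y + e / 2"] e by auto
  have "qnrm I (x \<oplus> y) \<le> nrm A ((x \<oplus> y) \<ominus> (i \<oplus> j))"
    using i j x y by (intro qnrm_le I.a_closed) auto
  also have "\<dots> \<le> nrm A (x \<ominus> i) + nrm A (y \<ominus> j)"
    using i j x y by (simp add: add_diff_add I.a_Hcarr nrm_triangle)
  finally show "qnrm I (x \<oplus> y) \<le> qnrm I x + qnrm I y + e"
    using i j by simp
qed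

text \<open>Common source of the bounds for scalars and for multiplication on either side: an almost
  optimal element of \<open>I\<close> is moved along with \<open>x\<close>.\<close>

lemma qnrm_map_le:
  assumes x: "x \<in> carrier A" and B: "0 \<le> B"
    and T: "T x \<in> carrier A" "\<And>i. i \<in> I \<Longrightarrow> T i \<in> I"
    and le: "\<And>i. i \<in> I \<Longrightarrow> nrm A (T x \<ominus> T i) \<le> B * nrm A (x \<ominus> i)"
  shows "qnrm I (T x) \<le> B * qnrm I x"
proof (rule field_le_epsilon)
  fix e :: real assume e: "0 < e"
  obtain i where i: "i \<in> I" "nrm A (x \<ominus> i) < qnrm I x + e / (B + 1)"
    using qnrm_less[OF x, of "qnrm I x + e / (B + 1)"] e B by auto
  have "qnrm I (T x) \<le> B * nrm A (x \<ominus> i)"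
    using qnrm_le[OF T(1) T(2)[OF i(1)]] le[OF i(1)] by simp
  also have "\<dots> \<le> B * (qnrm I x + e / (B + 1))"
    using i(2) B by (intro mult_left_mono) auto
  also have "\<dots> \<le> B * qnrm I x + e"
    using B e by (simp add: field_simps)
  finally show "qnrm I (T x) \<le> B * qnrm I x + e" .
qed

lemma qnrm_scal:
  assumes "x \<in> carrier A"
  shows "qnrm I (c \<odot> x) \<le> cmod c * qnrm I x"
  using assms
  by (intro qnrm_map_le[where T = "\<lambda>x. c \<odot> x"])
    (auto simp: ideal_scal I.a_Hcarr nrm_smult simp flip: scal_diff_right)

lemma qnrm_mult_left:
  assumes "x \<in> carrier A" "a \<in> carrier A"
  shows "qnrm I (a \<otimes> x) \<le> nrm A a * qnrm I x"
  using assms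
  by (intro qnrm_map_le[where T = "\<lambda>x. a \<otimes> x"])
    (auto simp: I.I_l_closed I.a_Hcarr nrm_nonneg nrm_mult simp flip: mult_diff_left)

lemma qnrm_mult_right:
  assumes "x \<in> carrier A" "a \<in> carrier A"
  shows "qnrm I (x \<otimes> a) \<le> nrm A a * qnrm I x"
  using assms nrm_mult
  by (intro qnrm_map_le[where T = "\<lambda>x. x \<otimes> a"])
    (auto simp: I.I_r_closed I.a_Hcarr nrm_nonneg mult.commute[of "nrm A a"] simp flip: mult_diff_right)

lemma qnrm_eq_0I: "x \<in> I \<Longrightarrow> qnrm I x = 0"
  using qnrm_le[of x x] qnrm_nonneg[of x] by (simp add: I.a_Hcarr minus_self nrm_zero)

lemma qnrm_cgr: assumes "cgr I x y" shows "qnrm I x = qnrm I y"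
proof -
  have le: "qnrm I x \<le> qnrm I y" if "cgr I x y" for x y
  proof -
    have "x = (x \<ominus> y) \<oplus> y"
      using that by (simp add: cgr_def a_minus_def M.a_assoc M.l_neg)
    then show ?thesis
      using qnrm_add[of "x \<ominus> y" y] qnrm_eq_0I[of "x \<ominus> y"] that by (simp add: cgr_def)
  qed
  show ?thesis
    using le[OF assms] le[OF cgr_sym[OF assms]] by simp
qed

lemma qnrm_eq_0D:
  assumes "norm_closed A I" "x \<in> carrier A" "qnrm I x = 0"
  shows "x \<in> I"
proof -
  have "\<exists>y\<in>I. nrm A (x \<ominus> y) < e" if "e > 0" for e
    using qnrm_less[OF assms(2), of e] that assms(3) by auto
  then show ?thesis
    using assms unfolding norm_closed_iff by blast
qed

end

lemma qnrm_antimono: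
  assumes "ideal I A" "ideal K A" "K \<subseteq> I" "x \<in> carrier A"
  shows "qnrm I x \<le> qnrm K x"
proof -
  have "K \<noteq> {}"
    using assms(2) by (rule ideal_nonempty)
  then show ?thesis
    unfolding qnrm_def[of K] using assms by (intro cINF_greatest qnrm_le) auto
qed

end

section \<open>The ideal absorbed by the monomials\<close>

text \<open>Irrationality of the angle enters in the form that \<open>lam\<close> has infinite
  order.\<close>

locale twisted_pair = cstar_algebra A for A :: "'a cstar" (structure) +
  fixes u v :: 'a and lam :: complex
  assumes u: "isometry A u" and v: "isometry A v"
    and uv: "u \<otimes> v = lam \<odot> (v \<otimes> u)"
    and norm_lam: "cmod lam = 1"
    and lam_not_root_of_unity: "\<And>n :: int. lam powi n = 1 \<Longrightarrow> n = 0"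
    and gen: "cstar_gen A {u, v} = carrier A"
begin

lemma lam_nonzero [simp]: "lam \<noteq> 0"
  using norm_lam by auto

lemma carriers [simp, intro]:
  "u \<in> carrier A" "v \<in> carrier A" "adj A u \<in> carrier A" "adj A v \<in> carrier A"
  using u v by (auto simp: isometry_def adj_closed)

lemma adj_mult_self: "adj A u \<otimes> u = \<one>" "adj A v \<otimes> v = \<one>"
  using u v by (auto simp: isometry_def)

lemma vu: "v \<otimes> u = inverse lam \<odot> (u \<otimes> v)"
  by (simp add: uv scal_scal scal_one)

text \<open>The right multipliers of \<open>D\<close> whose adjoints are also right multipliers form
  a closed subalgebra stable under adjoints. It contains \<open>u\<close> and \<open>v\<close>,
  hence everything. This extends statements about the four generators to all of \<open>A\<close>,
  for \<open>absorb\<close> and for \<open>limits\<close>.\<close>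

lemma mult_right_invariant:
  assumes D: "norm_closed A D"
    and add: "\<And>x y. x \<in> D \<Longrightarrow> y \<in> D \<Longrightarrow> x \<oplus> y \<in> D"
    and scal: "\<And>c x. x \<in> D \<Longrightarrow> c \<odot> x \<in> D"
    and gens: "\<And>x g. x \<in> D \<Longrightarrow> g \<in> {u, v, adj A u, adj A v} \<Longrightarrow> x \<otimes> g \<in> D"
    and d: "d \<in> D" and x: "x \<in> carrier A"
  shows "d \<otimes> x \<in> D"
proof -
  have D_sub: "d \<in> carrier A" if "d \<in> D" for d
    using D that by (auto simp: norm_closed_iff)
  define B where "B = {x \<in> carrier A. \<forall>d\<in>D. d \<otimes> x \<in> D \<and> d \<otimes> adj A x \<in> D}"
  have "cstar_subalgebra A B"
    unfolding cstar_subalgebra_def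
  proof (intro conjI ballI allI)
    have B_scal: "c \<odot> x \<in> B" if "x \<in> B" for c x
      using that by (auto simp: B_def adj_smult smult_mult_right D_sub adj_closed scal)
    show "subring B A"
    proof (rule subringI)
      show "\<one> \<in> B" by (auto simp: B_def adj_one D_sub)
      show "\<ominus> h \<in> B" if "h \<in> B" for h
        using B_scal[OF that, of "-1"] that by (simp add: B_def scal_uminus_one)
      show "g \<otimes> h \<in> B" if "g \<in> B" "h \<in> B" for g h
        using that by (auto simp: B_def adj_mult adj_closed D_sub simp flip: m_assoc)
      show "g \<oplus> h \<in> B" if "g \<in> B" "h \<in> B" for g h
        using that by (auto simp: B_def adj_add adj_closed D_sub r_distr add)
    qed (auto simp: B_def)
    show "c \<odot> x \<in> B" if "x \<in> B" for c x by (rule B_scal) fact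
    show "adj A x \<in> B" if "x \<in> B" for x
      using that by (auto simp: B_def adj_closed adj_adj)
    have bound: "nrm A (d \<otimes> x \<ominus> d \<otimes> y) \<le> nrm A d * nrm A (x \<ominus> y)"
      if "d \<in> D" "x \<in> carrier A" "y \<in> carrier A" for d x y
      using that nrm_mult[of d "x \<ominus> y"] by (simp add: mult_diff_left D_sub)
    have "norm_closed A {x \<in> carrier A. d \<otimes> x \<in> D}" "norm_closed A {x \<in> carrier A. d \<otimes> adj A x \<in> D}"
      if d: "d \<in> D" for d
    proof -
      show "norm_closed A {x \<in> carrier A. d \<otimes> x \<in> D}"
        using d bound by (intro norm_closed_preimage[OF D, of _ "nrm A d"]) (auto simp: D_sub)
      have "nrm A (d \<otimes> adj A x \<ominus> d \<otimes> adj A y) \<le> nrm A d * nrm A (x \<ominus> y)"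
        if "x \<in> carrier A" "y \<in> carrier A" for x y
      proof -
        have "nrm A (adj A x \<ominus> adj A y) = nrm A (x \<ominus> y)"
          using that by (simp add: nrm_adj flip: adj_diff)
        then show ?thesis
          using that d bound[of d "adj A x" "adj A y"] by (simp add: adj_closed)
      qed
      then show "norm_closed A {x \<in> carrier A. d \<otimes> adj A x \<in> D}"
        using d
        by (intro norm_closed_preimage[OF D, of _ "nrm A d"]) (simp_all add: D_sub adj_closed)
    qed
    \<comment> \<open>\<open>B\<close> is an intersection of preimages of \<open>D\<close>; adding
      \<open>carrier A\<close> makes the family visibly nonempty.\<close>
    then have "norm_closed A (\<Inter> (insert (carrier A) (\<Union>d\<in>D. {{x \<in> carrier A. d \<otimes> x \<in> D}, {x \<in> carrier A. d \<otimes> adj A x \<in> D}})))"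
      by (intro norm_closed_Inter) (auto simp: norm_closed_carrier)
    moreover have "\<Inter> (insert (carrier A) (\<Union>d\<in>D. {{x \<in> carrier A. d \<otimes> x \<in> D}, {x \<in> carrier A. d \<otimes> adj A x \<in> D}})) = B"
      unfolding B_def by auto
    ultimately show "norm_closed A B" by simp
  qed
  moreover have "{u, v} \<subseteq> B"
    unfolding B_def using gens by auto
  ultimately have "cstar_gen A {u, v} \<subseteq> B"
    unfolding cstar_gen_def by blast
  then show ?thesis
    using gen x d by (auto simp: B_def)
qed

text \<open>Since \<open>u\<^sup>* u\<^sup>k v\<^sup>l\<close> and \<open>v\<^sup>* u\<^sup>k v\<^sup>l\<close> are again multiples of such monomials, right multiplication
  by a generator only shifts the indices. This makes \<open>absorb\<close> a right ideal.\<close>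

definition W :: "nat \<Rightarrow> nat \<Rightarrow> 'a" where
  "W k l = u [^] k \<otimes> v [^] l"

lemma W_closed [simp]: "W k l \<in> carrier A"
  by (simp add: W_def)

lemma isometry_W: "isometry A (W k l)"
  unfolding W_def by (intro isometry_mult isometry_pow u v)

lemma u_W: "u \<otimes> W k l = W (Suc k) l"
  unfolding W_def using nat_pow_Suc2[of u k] by (simp only: m_assoc carriers nat_pow_closed)

lemma v_u_pow: "v \<otimes> u [^] (k :: nat) = inverse lam ^ k \<odot> (u [^] k \<otimes> v)"
proof (induction k)
  case 0
  then show ?case by (simp add: scal_one)
next
  case (Suc k)
  have "v \<otimes> u [^] Suc k = (v \<otimes> u [^] k) \<otimes> u"
    by (simp add: m_assoc)
  also have "\<dots> = inverse lam ^ k \<odot> (u [^] k \<otimes> (v \<otimes> u))"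
    by (simp add: Suc smult_mult_left m_assoc)
  also have "\<dots> = inverse lam ^ Suc k \<odot> (u [^] Suc k \<otimes> v)"
    by (simp add: vu smult_mult_right scal_scal m_assoc mult.commute)
  finally show ?case .
qed

lemma v_W: "v \<otimes> W k l = inverse lam ^ k \<odot> W k (Suc l)"
proof -
  have "v \<otimes> W k l = (v \<otimes> u [^] k) \<otimes> v [^] l"
    by (simp add: W_def m_assoc)
  also have "\<dots> = inverse lam ^ k \<odot> (u [^] k \<otimes> (v \<otimes> v [^] l))"
    by (simp add: v_u_pow smult_mult_left m_assoc)
  finally show ?thesis
    unfolding W_def using nat_pow_Suc2[of v l] by (simp only: carriers)
qed

text \<open>Brings a factor \<open>v\<close> to the front, where \<open>adj A v\<close> and the
  defect of \<open>v\<close> can meet it; the scalar is the price of crossing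
  \<open>u [^] k\<close>.\<close>

lemma W_Suc_right: "W k (Suc l) = lam ^ k \<odot> (v \<otimes> W k l)"
  by (simp add: v_W scal_scal scal_one flip: power_mult_distrib)

lemma adj_u_W: "adj A u \<otimes> W (Suc k) l = W k l"
  by (simp add: adj_mult_self flip: u_W m_assoc)

lemma adj_v_W: "adj A v \<otimes> W k (Suc l) = lam ^ k \<odot> W k l"
  by (simp add: W_Suc_right smult_mult_right adj_mult_self flip: m_assoc)

lemma defect_mult: "x \<in> {u, v} \<Longrightarrow> (\<one> \<ominus> x \<otimes> adj A x) \<otimes> x = \<zero>"
  by (auto simp: mult_diff_right m_assoc adj_mult_self minus_self)

lemma defect_u_W: "(\<one> \<ominus> u \<otimes> adj A u) \<otimes> W (Suc k) l = \<zero>"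
  by (simp add: defect_mult flip: u_W m_assoc)

lemma defect_v_W: "(\<one> \<ominus> v \<otimes> adj A v) \<otimes> W k (Suc l) = \<zero>"
  by (simp add: W_Suc_right smult_mult_right defect_mult scal_zero_right flip: m_assoc)

text \<open>The two indices tend to infinity independently, so that the condition survives a shift
  of only one of them.\<close>

definition absorb :: "'a set \<Rightarrow> 'a set" where
  "absorb I = {x \<in> carrier A. \<forall>e>0. \<exists>N. \<forall>k\<ge>N. \<forall>l\<ge>N. qnrm I (x \<otimes> W k l) < e}"

lemma absorbI:
  assumes "x \<in> carrier A" "\<And>e. e > 0 \<Longrightarrow> \<exists>N. \<forall>k\<ge>N. \<forall>l\<ge>N. qnrm I (x \<otimes> W k l) < e"
  shows "x \<in> absorb I"
  using assms by (auto simp: absorb_def)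

context
  fixes I assumes ideal: "ideal I A"
begin

interpretation I: ideal I A by (rule ideal)

lemma absorb_defects: "\<one> \<ominus> u \<otimes> adj A u \<in> absorb I" "\<one> \<ominus> v \<otimes> adj A v \<in> absorb I"
proof (rule absorbI)
  fix e :: real assume "e > 0"
  then have "\<forall>k\<ge>1. \<forall>l\<ge>1. qnrm I ((\<one> \<ominus> u \<otimes> adj A u) \<otimes> W k l) < e"
    by (auto simp: defect_u_W qnrm_zero[OF ideal] dest!: Suc_le_D)
  then show "\<exists>N. \<forall>k\<ge>N. \<forall>l\<ge>N. qnrm I ((\<one> \<ominus> u \<otimes> adj A u) \<otimes> W k l) < e" ..
next
  show "\<one> \<ominus> v \<otimes> adj A v \<in> absorb I"
  proof (rule absorbI)
    fix e :: real assume "e > 0"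
    then have "\<forall>k\<ge>1. \<forall>l\<ge>1. qnrm I ((\<one> \<ominus> v \<otimes> adj A v) \<otimes> W k l) < e"
      by (auto simp: defect_v_W qnrm_zero[OF ideal] dest!: Suc_le_D)
    then show "\<exists>N. \<forall>k\<ge>N. \<forall>l\<ge>N. qnrm I ((\<one> \<ominus> v \<otimes> adj A v) \<otimes> W k l) < e" ..
  qed simp
qed simp

lemma subset_absorb: "I \<subseteq> absorb I"
  by (auto intro!: absorbI simp: I.a_Hcarr I.I_r_closed qnrm_eq_0I[OF ideal])

text \<open>All \<open>W k l\<close> have norm at most 1, so right multiplication by them is
  contractive uniformly in \<open>k\<close> and \<open>l\<close>.\<close>

lemma absorb_norm_closed: "norm_closed A (absorb I)"
  unfolding norm_closed_iff
proof (intro conjI ballI impI)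
  fix x assume x: "x \<in> carrier A" and lim: "\<forall>e>0. \<exists>y\<in>absorb I. nrm A (x \<ominus> y) < e"
  show "x \<in> absorb I"
  proof (rule absorbI[OF x])
    fix e :: real assume e: "e > 0"
    then obtain y where y: "y \<in> absorb I" "nrm A (x \<ominus> y) < e / 2"
      using lim by (meson half_gt_zero)
    then have yc: "y \<in> carrier A" by (simp add: absorb_def)
    obtain N where N: "\<forall>k\<ge>N. \<forall>l\<ge>N. qnrm I (y \<otimes> W k l) < e / 2"
      using y(1) e unfolding absorb_def by (auto dest: spec[of _ "e / 2"])
    have "qnrm I (x \<otimes> W k l) < e" if "k \<ge> N" "l \<ge> N" for k l
    proof -
      have "x \<otimes> W k l = (x \<ominus> y) \<otimes> W k l \<oplus> y \<otimes> W k l"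
        using x yc diff_add_cancel[of x y] l_distr[of "x \<ominus> y" y "W k l"] by simp
      then have "qnrm I (x \<otimes> W k l) \<le> qnrm I ((x \<ominus> y) \<otimes> W k l) + qnrm I (y \<otimes> W k l)"
        using x yc qnrm_add[OF ideal, of "(x \<ominus> y) \<otimes> W k l" "y \<otimes> W k l"] by simp
      moreover have "qnrm I ((x \<ominus> y) \<otimes> W k l) \<le> nrm A ((x \<ominus> y) \<otimes> W k l)"
        using x yc by (intro qnrm_le_nrm[OF ideal]) simp
      moreover have "nrm A ((x \<ominus> y) \<otimes> W k l) \<le> nrm A (x \<ominus> y) * nrm A (W k l)"
        using x yc by (intro nrm_mult) auto
      moreover have "nrm A (x \<ominus> y) * nrm A (W k l) \<le> nrm A (x \<ominus> y)"
        using x yc nrm_isometry_le[OF isometry_W] by (intro mult_left_le nrm_nonneg) auto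
      ultimately show ?thesis
        using N y(2) that by fastforce
    qed
    then show "\<exists>N. \<forall>k\<ge>N. \<forall>l\<ge>N. qnrm I (x \<otimes> W k l) < e" by blast
  qed
qed (auto simp: absorb_def)

lemma absorb_add:
  assumes "x \<in> absorb I" "y \<in> absorb I"
  shows "x \<oplus> y \<in> absorb I"
proof -
  have xy: "x \<in> carrier A" "y \<in> carrier A" using assms by (auto simp: absorb_def)
  show ?thesis
  proof (rule absorbI)
    fix e :: real assume e: "e > 0"
    obtain N where N: "\<forall>k\<ge>N. \<forall>l\<ge>N. qnrm I (x \<otimes> W k l) < e / 2"
      using assms(1) e unfolding absorb_def by (auto dest: spec[of _ "e / 2"])
    obtain N' where N': "\<forall>k\<ge>N'. \<forall>l\<ge>N'. qnrm I (y \<otimes> W k l) < e / 2"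
      using assms(2) e unfolding absorb_def by (auto dest: spec[of _ "e / 2"])
    have "qnrm I ((x \<oplus> y) \<otimes> W k l) < e" if "k \<ge> max N N'" "l \<ge> max N N'" for k l
    proof -
      have "qnrm I ((x \<oplus> y) \<otimes> W k l) \<le> qnrm I (x \<otimes> W k l) + qnrm I (y \<otimes> W k l)"
        using xy qnrm_add[OF ideal, of "x \<otimes> W k l" "y \<otimes> W k l"] by (simp add: l_distr)
      then show ?thesis using N N' that by fastforce
    qed
    then show "\<exists>N. \<forall>k\<ge>N. \<forall>l\<ge>N. qnrm I ((x \<oplus> y) \<otimes> W k l) < e" by blast
  qed (use xy in simp)
qed

lemma absorb_mult_left:
  assumes "x \<in> absorb I" "a \<in> carrier A"
  shows "a \<otimes> x \<in> absorb I"
proof -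
  have x: "x \<in> carrier A" using assms by (simp add: absorb_def)
  show ?thesis
  proof (rule absorbI)
    fix e :: real assume e: "e > 0"
    define d where "d = e / (nrm A a + 1)"
    have d: "d > 0" "nrm A a * d < e"
      using e nrm_nonneg[OF assms(2)] by (auto simp: d_def field_simps)
    obtain N where N: "\<forall>k\<ge>N. \<forall>l\<ge>N. qnrm I (x \<otimes> W k l) < d"
      using assms(1) d unfolding absorb_def by auto
    have "qnrm I ((a \<otimes> x) \<otimes> W k l) < e" if "k \<ge> N" "l \<ge> N" for k l
    proof -
      have "qnrm I ((a \<otimes> x) \<otimes> W k l) \<le> nrm A a * qnrm I (x \<otimes> W k l)"
        using x assms(2) qnrm_mult_left[OF ideal, of "x \<otimes> W k l" a] by (simp add: m_assoc)
      also have "\<dots> \<le> nrm A a * d"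
        using N that nrm_nonneg[OF assms(2)] by (intro mult_left_mono) (auto intro: less_imp_le)
      finally show ?thesis using d by simp
    qed
    then show "\<exists>N. \<forall>k\<ge>N. \<forall>l\<ge>N. qnrm I ((a \<otimes> x) \<otimes> W k l) < e" by blast
  qed (use x assms in simp)
qed

lemma absorb_scal:
  assumes "x \<in> absorb I"
  shows "c \<odot> x \<in> absorb I"
  using absorb_mult_left[OF assms, of "c \<odot> \<one>"] assms
  by (simp add: smult_mult_left absorb_def)

text \<open>Starting at \<open>Suc k\<close> and \<open>Suc l\<close> gives the adjoints a factor to
  cancel. The new indices are still at least \<open>k\<close> and \<open>l\<close>, so a threshold
  \<open>N\<close> for \<open>x\<close> yields the threshold \<open>Suc N\<close> for
  \<open>x \<otimes> g\<close>.\<close>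

lemma absorb_shift:
  assumes x: "x \<in> absorb I" and g: "g \<in> carrier A"
    and shift: "\<And>k l. g \<otimes> W (Suc k) (Suc l) = c k l \<odot> W (s k) (t l)"
    and c: "\<And>k l. cmod (c k l) = 1" and st: "\<And>k. k \<le> s k" "\<And>l. l \<le> t l"
  shows "x \<otimes> g \<in> absorb I"
proof -
  have xc: "x \<in> carrier A" using x by (simp add: absorb_def)
  show ?thesis
  proof (rule absorbI)
    fix e :: real assume "e > 0"
    then obtain N where N: "\<forall>k\<ge>N. \<forall>l\<ge>N. qnrm I (x \<otimes> W k l) < e"
      using x unfolding absorb_def by auto
    have "qnrm I ((x \<otimes> g) \<otimes> W (Suc k) (Suc l)) < e" if "k \<ge> N" "l \<ge> N" for k l
    proof -
      have "qnrm I ((x \<otimes> g) \<otimes> W (Suc k) (Suc l)) \<le> qnrm I (x \<otimes> W (s k) (t l))"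
        using xc g qnrm_scal[OF ideal, of "x \<otimes> W (s k) (t l)" "c k l"]
        by (simp add: m_assoc shift smult_mult_right c)
      then show ?thesis
        using N that st order_trans by (meson order_le_less_trans)
    qed
    then have "\<forall>k\<ge>Suc N. \<forall>l\<ge>Suc N. qnrm I ((x \<otimes> g) \<otimes> W k l) < e"
      by (metis Suc_le_D Suc_le_mono)
    then show "\<exists>N. \<forall>k\<ge>N. \<forall>l\<ge>N. qnrm I ((x \<otimes> g) \<otimes> W k l) < e" ..
  qed (use xc g in simp)
qed

lemma absorb_mult_right:
  assumes "x \<in> absorb I" "a \<in> carrier A"
  shows "x \<otimes> a \<in> absorb I"
proof (rule mult_right_invariant[OF absorb_norm_closed absorb_add absorb_scal _ assms])
  fix x g assume x: "x \<in> absorb I" and g: "g \<in> {u, v, adj A u, adj A v}"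
  have n: "cmod (inverse lam ^ k) = 1" "cmod (lam ^ k) = 1" for k
    by (auto simp: norm_power norm_inverse norm_lam)
  show "x \<otimes> g \<in> absorb I"
    using g
  proof (elim insertE emptyE)
    assume "g = u"
    then show ?thesis
      using absorb_shift[OF x, of g "\<lambda>k l. 1" "\<lambda>k. Suc (Suc k)" Suc] by (simp add: u_W scal_one)
  next
    assume "g = v"
    then show ?thesis
      using absorb_shift[OF x, of g "\<lambda>k l. inverse lam ^ Suc k" Suc "\<lambda>l. Suc (Suc l)"] n
      by (simp add: v_W del: power_Suc)
  next
    assume "g = adj A u"
    then show ?thesis
      using absorb_shift[OF x, of g "\<lambda>k l. 1" "\<lambda>k. k" Suc] by (simp add: adj_u_W scal_one)
  next
    assume "g = adj A v"
    then show ?thesis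
      using absorb_shift[OF x, of g "\<lambda>k l. lam ^ Suc k" Suc "\<lambda>l. l"] n
      by (simp add: adj_v_W del: power_Suc)
  qed
qed

lemma ideal_absorb: "ideal (absorb I) A"
proof (rule idealI)
  show "subgroup (absorb I) (add_monoid A)"
  proof (rule add.subgroupI)
    show "absorb I \<noteq> {}"
      using subset_absorb ideal_nonempty[OF ideal] by auto
    show "\<ominus> x \<in> absorb I" if "x \<in> absorb I" for x
      using absorb_scal[OF that, of "-1"] that by (simp add: absorb_def scal_uminus_one)
    show "x \<oplus>\<^bsub>A\<^esub> y \<in> absorb I" if "x \<in> absorb I" "y \<in> absorb I" for x y
      using that by (rule absorb_add)
  qed (auto simp: absorb_def)
qed (auto intro: absorb_mult_left absorb_mult_right ring_axioms)

text \<open>\<open>adj A (W k l)\<close> has norm at most 1 and turns \<open>W k l\<close> back into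
  \<open>\<one>\<close>. So \<open>\<one>\<close> is no larger modulo \<open>I\<close> than
  \<open>W k l\<close>, which would become arbitrarily small.\<close>

lemma one_notin_absorb:
  assumes "norm_closed A I" "I \<noteq> carrier A"
  shows "\<one> \<notin> absorb I"
proof
  assume one: "\<one> \<in> absorb I"
  have "qnrm I \<one> \<le> e" if e: "e > 0" for e
  proof -
    obtain k l where kl: "qnrm I (\<one> \<otimes> W k l) < e"
      using one e unfolding absorb_def by blast
    have W: "W k l \<in> carrier A" "adj A (W k l) \<otimes> W k l = \<one>" "nrm A (W k l) \<le> 1"
      using isometry_W[of k l] nrm_isometry_le by (auto simp: isometry_def)
    have "qnrm I \<one> \<le> nrm A (adj A (W k l)) * qnrm I (W k l)"
      using qnrm_mult_left[OF ideal W(1), of "adj A (W k l)"] W by (simp add: adj_closed)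
    also have "\<dots> \<le> qnrm I (W k l)"
      using W qnrm_nonneg[OF ideal W(1)] by (simp add: nrm_adj mult_left_le_one_le nrm_nonneg)
    finally show ?thesis using kl W by simp
  qed
  then have "qnrm I \<one> = 0"
    using qnrm_nonneg[OF ideal, of \<one>] by (metis dual_order.antisym field_le_epsilon add_0 one_closed)
  then have "\<one> \<in> I"
    using assms by (intro qnrm_eq_0D[OF ideal]) auto
  then show False
    using assms I.one_imp_carrier by simp
qed

end

end

section \<open>Monomials with integer exponents\<close>

definition (in cstar_algebra) lc :: "('i \<Rightarrow> 'a) \<Rightarrow> ('i \<Rightarrow> complex) \<Rightarrow> 'i set \<Rightarrow> 'a" where
  "lc E c F = (\<Oplus>i\<in>F. c i \<odot> E i)"

context cstar_algebra
begin

context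
  fixes E :: "'i \<Rightarrow> 'a" assumes E: "\<And>i. E i \<in> carrier A"
begin

lemma lc_closed [simp]: "lc E c F \<in> carrier A"
  unfolding lc_def by (intro M.finsum_closed) (auto simp: E)

lemma lc_empty: "lc E c {} = \<zero>"
  by (simp add: lc_def)

lemma lc_insert: "finite F \<Longrightarrow> i \<notin> F \<Longrightarrow> lc E c (insert i F) = c i \<odot> E i \<oplus> lc E c F"
  unfolding lc_def by (intro M.finsum_insert) (auto simp: E)

lemma lc_cong: "(\<And>i. i \<in> F \<Longrightarrow> c i = d i) \<Longrightarrow> lc E c F = lc E d F"
  unfolding lc_def by (intro M.finsum_cong') (auto simp: E)

lemma lc_add: "lc E (\<lambda>i. c i + d i) F = lc E c F \<oplus> lc E d F"
  unfolding lc_def by (simp add: scal_add_left E M.finsum_addf)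

lemma lc_scal: assumes "finite F" shows "lc E (\<lambda>i. a * c i) F = a \<odot> lc E c F"
  using assms
proof induction
  case (insert i F)
  then show ?case by (simp add: lc_insert scal_add_right scal_scal E)
qed (simp add: lc_empty scal_zero_right)

lemma lc_extend:
  assumes "finite F'" "F \<subseteq> F'"
  shows "lc E (\<lambda>i. if i \<in> F then c i else 0) F' = lc E c F"
  unfolding lc_def using assms
  by (intro M.add.finprod_mono_neutral_cong_right) (auto simp: scal_zero E)

lemma lc_single: assumes "finite F" "i \<in> F" shows "lc E (\<lambda>j. of_bool (j = i) * c j) F = c i \<odot> E i"
proof -
  have "lc E (\<lambda>j. of_bool (j = i) * c j) F = lc E (\<lambda>j. if j \<in> {i} then c j else 0) F"
    by (rule lc_cong) auto
  also have "\<dots> = lc E c {i}"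
    using assms by (intro lc_extend) auto
  also have "\<dots> = c i \<odot> E i"
    by (simp add: lc_insert lc_empty E)
  finally show ?thesis .
qed

lemma finitary_seminorm_lc:
  assumes "ideal I A" "finite F"
  shows "finitary_seminorm (\<lambda>c. qnrm I (lc E c F)) F"
proof
  show "finite F" by fact
  fix a :: complex and c d :: "'i \<Rightarrow> complex"
  show "qnrm I (lc E c F) = qnrm I (lc E d F)" if "\<And>i. i \<in> F \<Longrightarrow> c i = d i"
    using that by (intro arg_cong[where f = "qnrm I"] lc_cong)
  show "0 \<le> qnrm I (lc E c F)"
    using assms(1) by (rule qnrm_nonneg) simp
  show "qnrm I (lc E (\<lambda>i. c i + d i) F) \<le> qnrm I (lc E c F) + qnrm I (lc E d F)"
    unfolding lc_add using assms(1) by (rule qnrm_add) simp_all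
  show "qnrm I (lc E (\<lambda>i. a * c i) F) \<le> cmod a * qnrm I (lc E c F)"
    unfolding lc_scal[OF assms(2)] using assms(1) by (rule qnrm_scal) simp
qed

end

end

text \<open>\<open>b\<close> stands for an inverse of \<open>a\<close> that is available only modulo
  an ideal, so negative powers are powers of \<open>b\<close>.\<close>

definition (in cstar_algebra) ipow :: "'a \<Rightarrow> 'a \<Rightarrow> int \<Rightarrow> 'a" where
  "ipow a b z = (if 0 \<le> z then a [^] nat z else b [^] nat (- z))"

section \<open>Commutation up to a scalar and inverses modulo an ideal\<close>

locale ideal_quotient = cstar_algebra A for A :: "'a cstar" (structure) +
  fixes K :: "'a set" assumes ideal: "ideal K A"
begin

abbreviation eqv (infix \<open>\<doteq>\<close> 50) where "x \<doteq> y \<equiv> cgr K x y"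

definition comm :: "complex \<Rightarrow> 'a \<Rightarrow> 'a \<Rightarrow> bool" where
  "comm c x y \<longleftrightarrow> x \<otimes> y \<doteq> c \<odot> (y \<otimes> x)"

lemmas eqv_refl = cgr_refl[OF ideal]
  and eqv_sym = cgr_sym[OF ideal]
  and eqv_trans [trans] = cgr_trans[OF ideal]
  and eqv_scal = cgr_scal[OF ideal]
  and eqv_mult_left = cgr_mult_left[OF ideal]
  and eqv_mult_right = cgr_mult_right[OF ideal]

lemma comm_mult:
  assumes "comm c x y" "comm d x z" and [simp]: "x \<in> carrier A" "y \<in> carrier A" "z \<in> carrier A"
  shows "comm (c * d) x (y \<otimes> z)"
proof -
  have "(x \<otimes> y) \<otimes> z \<doteq> (c \<odot> (y \<otimes> x)) \<otimes> z"
    using assms(1) by (intro eqv_mult_right) (auto simp: comm_def)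
  also have "(c \<odot> (y \<otimes> x)) \<otimes> z = (c \<odot> y) \<otimes> (x \<otimes> z)"
    by (simp add: smult_mult_left m_assoc)
  also have "(c \<odot> y) \<otimes> (x \<otimes> z) \<doteq> (c \<odot> y) \<otimes> (d \<odot> (z \<otimes> x))"
    using assms(2) by (intro eqv_mult_left) (auto simp: comm_def)
  also have "(c \<odot> y) \<otimes> (d \<odot> (z \<otimes> x)) = (c * d) \<odot> (y \<otimes> z \<otimes> x)"
    by (simp add: smult_mult_left smult_mult_right scal_scal m_assoc mult.commute)
  finally show ?thesis
    by (simp add: comm_def m_assoc)
qed

lemma comm_cgr:
  assumes "comm c x y" "y \<doteq> y'" "x \<in> carrier A"
  shows "comm c x y'"
proof -
  have "x \<otimes> y' \<doteq> x \<otimes> y"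
    using assms by (intro eqv_mult_left eqv_sym[OF assms(2)])
  also have "x \<otimes> y \<doteq> c \<odot> (y \<otimes> x)"
    using assms by (simp add: comm_def)
  also have "c \<odot> (y \<otimes> x) \<doteq> c \<odot> (y' \<otimes> x)"
    using assms by (intro eqv_scal eqv_mult_right)
  finally show ?thesis
    by (simp add: comm_def)
qed

lemma comm_sym:
  assumes "comm c x y" "c \<noteq> 0" "x \<in> carrier A" "y \<in> carrier A"
  shows "comm (inverse c) y x"
proof -
  have "inverse c \<odot> (x \<otimes> y) \<doteq> inverse c \<odot> (c \<odot> (y \<otimes> x))"
    using assms by (intro eqv_scal) (auto simp: comm_def)
  then show ?thesis
    unfolding comm_def using assms by (simp add: scal_scal scal_one eqv_sym)
qed

lemma comm_one: "x \<in> carrier A \<Longrightarrow> comm 1 x \<one>"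
  by (simp add: comm_def scal_one eqv_refl)

lemma comm_self: "x \<in> carrier A \<Longrightarrow> comm 1 x x"
  by (simp add: comm_def scal_one eqv_refl)

lemma comm_conj:
  assumes "comm c x y" "x \<otimes> x' \<doteq> \<one>" "x' \<in> carrier A" "x \<in> carrier A" "y \<in> carrier A"
  shows "x \<otimes> y \<otimes> x' \<doteq> c \<odot> y"
proof -
  have "x \<otimes> y \<otimes> x' \<doteq> (c \<odot> (y \<otimes> x)) \<otimes> x'"
    using assms by (intro eqv_mult_right) (auto simp: comm_def)
  also have "(c \<odot> (y \<otimes> x)) \<otimes> x' = (c \<odot> y) \<otimes> (x \<otimes> x')"
    using assms by (simp add: smult_mult_left m_assoc)
  also have "(c \<odot> y) \<otimes> (x \<otimes> x') \<doteq> (c \<odot> y) \<otimes> \<one>"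
    using assms by (intro eqv_mult_left) auto
  finally show ?thesis
    using assms by simp
qed

lemma cancel_right:
  assumes "a \<otimes> b \<doteq> \<one>" "x \<in> carrier A" "a \<in> carrier A" "b \<in> carrier A"
  shows "x \<otimes> a \<otimes> b \<doteq> x"
  using assms eqv_mult_left[of "a \<otimes> b" \<one> x] by (simp add: m_assoc)

text \<open>Insert \<open>b \<otimes> a\<close> in front of \<open>x \<otimes> b\<close>, move
  \<open>a\<close> across \<open>x\<close>, and cancel \<open>a \<otimes> b\<close>.\<close>

lemma comm_inv:
  assumes "comm c x a" "c \<noteq> 0" "a \<otimes> b \<doteq> \<one>" "b \<otimes> a \<doteq> \<one>"
    and [simp]: "x \<in> carrier A" "a \<in> carrier A" "b \<in> carrier A"
  shows "comm (inverse c) x b"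
proof -
  have "x \<otimes> b \<doteq> (b \<otimes> a) \<otimes> (x \<otimes> b)"
    using eqv_sym[OF eqv_mult_right[OF assms(4), of "x \<otimes> b"]] by simp
  also have "(b \<otimes> a) \<otimes> (x \<otimes> b) = b \<otimes> (a \<otimes> x) \<otimes> b"
    by (simp add: m_assoc)
  also have "b \<otimes> (a \<otimes> x) \<otimes> b \<doteq> b \<otimes> (inverse c \<odot> (x \<otimes> a)) \<otimes> b"
    using comm_sym[OF assms(1,2)] by (intro eqv_mult_right eqv_mult_left) (auto simp: comm_def)
  also have "b \<otimes> (inverse c \<odot> (x \<otimes> a)) \<otimes> b = (inverse c \<odot> (b \<otimes> x)) \<otimes> a \<otimes> b"
    by (simp add: smult_mult_left smult_mult_right m_assoc)
  also have "(inverse c \<odot> (b \<otimes> x)) \<otimes> a \<otimes> b \<doteq> inverse c \<odot> (b \<otimes> x)"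
    using assms(3) by (intro cancel_right) auto
  finally show ?thesis
    by (simp add: comm_def)
qed

lemma ipow_int: "ipow a b (int n) = a [^] n" and ipow_minus_int: "ipow a b (- int n) = b [^] n"
  by (auto simp: ipow_def)

lemma ipow_closed [simp]: "a \<in> carrier A \<Longrightarrow> b \<in> carrier A \<Longrightarrow> ipow a b z \<in> carrier A"
  by (cases z rule: int_cases2) (simp_all add: ipow_int ipow_minus_int)

lemma ipow_minus: "ipow a b (- z) = ipow b a z"
  by (cases z rule: int_cases2) (simp_all add: ipow_int ipow_minus_int)

lemma ipow_succ:
  assumes "b \<otimes> a \<doteq> \<one>" and [simp]: "a \<in> carrier A" "b \<in> carrier A"
  shows "ipow a b z \<otimes> a \<doteq> ipow a b (z + 1)"
proof (cases "0 \<le> z")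
  case True
  then obtain n where "z = int n" by (rule nonneg_int_cases)
  then show ?thesis
    using ipow_int[of a b "Suc n"] by (simp add: ipow_int eqv_refl add.commute)
next
  case False
  define n where "n = nat (- z - 1)"
  have n: "z = - int (Suc n)" "z + 1 = - int n"
    using False by (auto simp: n_def)
  show ?thesis
    unfolding n(2) unfolding n(1) ipow_minus_int
    using cancel_right[OF assms(1), of "b [^] n"] by simp
qed

lemma ipow_pred:
  assumes "a \<otimes> b \<doteq> \<one>" "a \<in> carrier A" "b \<in> carrier A"
  shows "ipow a b z \<otimes> b \<doteq> ipow a b (z - 1)"
  using ipow_succ[OF assms(1,3,2), of "- z"] ipow_minus[of a b "- z"] ipow_minus[of a b "1 - z"]
  by (simp add: ipow_minus[of b a z])

lemma comm_ipow:
  assumes "comm c x a" "c \<noteq> 0" "a \<otimes> b \<doteq> \<one>" "b \<otimes> a \<doteq> \<one>"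
    and [simp]: "x \<in> carrier A" "a \<in> carrier A" "b \<in> carrier A"
  shows "comm (c powi z) x (ipow a b z)"
proof (induction z rule: int_induct[where k = 0])
  case base
  then show ?case by (simp add: ipow_def comm_one)
next
  case (step1 i)
  have "comm (c powi i * c) x (ipow a b i \<otimes> a)"
    using step1 assms by (intro comm_mult) auto
  then have "comm (c powi i * c) x (ipow a b (i + 1))"
    using assms by (intro comm_cgr[OF _ ipow_succ]) auto
  then show ?case
    using assms(2) by (simp add: power_int_add)
next
  case (step2 i)
  have "comm (c powi i * inverse c) x (ipow a b i \<otimes> b)"
    using step2 assms comm_inv[OF assms(1-4)] by (intro comm_mult) auto
  then have "comm (c powi i * inverse c) x (ipow a b (i - 1))"
    using assms by (intro comm_cgr[OF _ ipow_pred]) auto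
  then show ?case
    using assms(2) by (simp add: power_int_diff divide_inverse)
qed

text \<open>A left inverse modulo \<open>K\<close> already keeps an element out of a proper
  \<open>K\<close>, and the property passes to products.\<close>

definition left_invertible :: "'a \<Rightarrow> bool" where
  "left_invertible x \<longleftrightarrow> x \<in> carrier A \<and> (\<exists>y\<in>carrier A. y \<otimes> x \<doteq> \<one>)"

lemma left_invertible_mult:
  assumes "left_invertible x" "left_invertible y"
  shows "left_invertible (x \<otimes> y)"
proof -
  obtain x' y' where x'y': "x' \<in> carrier A" "x' \<otimes> x \<doteq> \<one>" "y' \<in> carrier A" "y' \<otimes> y \<doteq> \<one>"
    and xy [simp]: "x \<in> carrier A" "y \<in> carrier A"
    using assms by (auto simp: left_invertible_def)
  have "(y' \<otimes> x') \<otimes> (x \<otimes> y) = y' \<otimes> (x' \<otimes> x) \<otimes> y"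
    using x'y' by (simp add: m_assoc)
  also have "y' \<otimes> (x' \<otimes> x) \<otimes> y \<doteq> y' \<otimes> \<one> \<otimes> y"
    using x'y' by (intro eqv_mult_right eqv_mult_left) auto
  also have "y' \<otimes> \<one> \<otimes> y \<doteq> \<one>"
    using x'y' by simp
  finally show ?thesis
    using x'y' by (auto simp: left_invertible_def intro!: bexI[of _ "y' \<otimes> x'"])
qed

lemma left_invertible_pow: "left_invertible x \<Longrightarrow> left_invertible (x [^] (n :: nat))"
proof (induction n)
  case 0
  then show ?case
    by (auto simp: left_invertible_def eqv_refl intro!: bexI[of _ \<one>])
qed (simp add: left_invertible_mult)

lemma left_invertible_notin:
  assumes "left_invertible x" "\<one> \<notin> K"
  shows "x \<notin> K"
proof
  assume x: "x \<in> K"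
  obtain y where y: "y \<in> carrier A" "y \<otimes> x \<doteq> \<one>"
    using assms(1) by (auto simp: left_invertible_def)
  interpret K: ideal K A by (rule ideal)
  have "(\<one> \<ominus> y \<otimes> x) \<oplus> y \<otimes> x \<in> K"
    using eqv_sym[OF y(2)] K.I_l_closed[OF x y(1)] by (intro K.a_closed) (auto simp: cgr_def)
  then show False
    using assms(2) cgr_carrier(1)[OF y(2)] by (simp add: diff_add_cancel)
qed

end

text \<open>\<open>K\<close> is any ideal with the two defects in it, because the estimates are
  applied to two ideals: \<open>fejer_bound\<close> modulo the smaller one and
  \<open>coefficient_bound\<close> modulo the larger one in \<open>maximal\<close>.\<close>

locale twisted_quotient = twisted_pair A u v lam + ideal_quotient A K
  for A :: "'a cstar" (structure) and u v :: 'a and lam :: complex and K :: "'a set" +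
  assumes defects: "\<one> \<ominus> u \<otimes> adj A u \<in> K" "\<one> \<ominus> v \<otimes> adj A v \<in> K"
begin

definition E :: "int \<times> int \<Rightarrow> 'a" where
  "E = (\<lambda>(k, l). ipow u (adj A u) k \<otimes> ipow v (adj A v) l)"

lemma E_closed [simp]: "E i \<in> carrier A"
  by (simp add: E_def split: prod.split)

lemma unitary: "u \<otimes> adj A u \<doteq> \<one>" "v \<otimes> adj A v \<doteq> \<one>" "adj A u \<otimes> u \<doteq> \<one>" "adj A v \<otimes> v \<doteq> \<one>"
proof -
  have "\<one> \<doteq> u \<otimes> adj A u" "\<one> \<doteq> v \<otimes> adj A v"
    using defects by (auto simp: cgr_def)
  then show "u \<otimes> adj A u \<doteq> \<one>" "v \<otimes> adj A v \<doteq> \<one>"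
    by (auto dest: eqv_sym)
qed (simp_all add: adj_mult_self eqv_refl)

lemma comm_u_v: "comm lam u v"
  by (simp add: comm_def uv eqv_refl)

lemma comm_u_E: "comm (lam powi snd i) u (E i)"
proof -
  have "comm (1 powi fst i * lam powi snd i) u (E i)"
    unfolding E_def case_prod_beta
    by (intro comm_mult comm_ipow comm_self comm_u_v unitary) simp_all
  then show ?thesis by simp
qed

lemma comm_v_E: "comm (inverse lam powi fst i) v (E i)"
proof -
  have "comm (inverse lam powi fst i * 1 powi snd i) v (E i)"
    unfolding E_def case_prod_beta
    by (intro comm_mult comm_ipow comm_self comm_sym[OF comm_u_v] unitary) simp_all
  then show ?thesis by simp
qed

text \<open>Makes the span of the monomials invariant modulo \<open>K\<close> under right
  multiplication. \<open>v\<close> and its adjoint change only the last factor; \<open>u\<close> and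
  its adjoint must first cross the power of \<open>v\<close>, which produces the scalar.\<close>

lemma E_mult_gen:
  assumes "g \<in> {u, v, adj A u, adj A v}"
  shows "\<exists>c j. E i \<otimes> g \<doteq> c \<odot> E j"
proof -
  obtain k l where i: "i = (k, l)" by (cases i)
  let ?U = "ipow u (adj A u)" and ?V = "ipow v (adj A v)"
  have V: "E i \<otimes> g \<doteq> 1 \<odot> E (k, l')" if "?V l \<otimes> g \<doteq> ?V l'" "g \<in> carrier A" for g l'
    using eqv_mult_left[OF that(1), of "?U k"] that(2) by (simp add: E_def i m_assoc scal_one)
  have U: "\<exists>c j. E i \<otimes> g \<doteq> c \<odot> E j"
    if c: "comm c (?V l) g" and g: "?U k \<otimes> g \<doteq> ?U k'" "g \<in> carrier A" for c g k'
  proof -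
    have "E i \<otimes> g = ?U k \<otimes> (?V l \<otimes> g)"
      using g by (simp add: E_def i m_assoc)
    also have "?U k \<otimes> (?V l \<otimes> g) \<doteq> ?U k \<otimes> (c \<odot> (g \<otimes> ?V l))"
      using c by (intro eqv_mult_left) (auto simp: comm_def)
    also have "?U k \<otimes> (c \<odot> (g \<otimes> ?V l)) = c \<odot> (?U k \<otimes> g \<otimes> ?V l)"
      using g by (simp add: smult_mult_right m_assoc)
    also have "c \<odot> (?U k \<otimes> g \<otimes> ?V l) \<doteq> c \<odot> E (k', l)"
      unfolding E_def prod.case using g by (intro eqv_scal eqv_mult_right) auto
    finally show ?thesis by blast
  qed
  have Vu: "comm (inverse (lam powi l)) (?V l) u"
    using unitary by (intro comm_sym comm_ipow comm_u_v) auto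
  then have Vu': "comm (inverse (inverse (lam powi l))) (?V l) (adj A u)"
    by (intro comm_inv[OF Vu] unitary) auto
  show ?thesis
    using assms
  proof (elim insertE emptyE)
    assume "g = u"
    with U[OF Vu ipow_succ] unitary show ?thesis by simp
  next
    assume "g = adj A u"
    with U[OF Vu' ipow_pred] unitary show ?thesis by simp
  next
    assume "g = v"
    with V[OF ipow_succ] unitary show ?thesis by blast
  next
    assume "g = adj A v"
    with V[OF ipow_pred] unitary show ?thesis by blast
  qed
qed

lemma E_notin: assumes "\<one> \<notin> K" shows "E i \<notin> K"
proof (rule left_invertible_notin[OF _ assms])
  have "left_invertible u" "left_invertible v" "left_invertible (adj A u)" "left_invertible (adj A v)"
    using unitary by (auto simp: left_invertible_def)
  then have "left_invertible (ipow u (adj A u) z)" "left_invertible (ipow v (adj A v) z)" for z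
    by (cases z rule: int_cases2; simp add: ipow_int ipow_minus_int left_invertible_pow)+
  then show "left_invertible (E i)"
    by (simp add: E_def case_prod_beta left_invertible_mult)
qed

lemma lc_conj:
  assumes g: "g \<in> carrier A" "g' \<in> carrier A" and E: "\<And>i. g \<otimes> E i \<otimes> g' \<doteq> a i \<odot> E i" and "finite F"
  shows "g \<otimes> lc E c F \<otimes> g' \<doteq> lc E (\<lambda>i. a i * c i) F"
  using \<open>finite F\<close>
proof induction
  case empty
  then show ?case using g by (simp add: lc_empty eqv_refl)
next
  case (insert i F)
  have "g \<otimes> lc E c (insert i F) \<otimes> g' = c i \<odot> (g \<otimes> E i \<otimes> g') \<oplus> g \<otimes> lc E c F \<otimes> g'"
    using g insert by (simp add: lc_insert l_distr r_distr smult_mult_left smult_mult_right)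
  also have "\<dots> \<doteq> c i \<odot> (a i \<odot> E i) \<oplus> lc E (\<lambda>i. a i * c i) F"
    using E insert by (intro cgr_add[OF ideal] eqv_scal) auto
  finally show ?case
    using insert by (simp add: lc_insert scal_scal mult.commute)
qed

text \<open>Conjugation by \<open>g\<close> maps \<open>K\<close> into itself and does not increase
  norms, as \<open>g\<close> and \<open>adj A g\<close> have norm at most 1; modulo \<open>K\<close>
  it is diagonal on the monomials.\<close>

lemma conj_bound:
  assumes g: "g \<in> {u, v}" and E: "\<And>i. g \<otimes> E i \<otimes> adj A g \<doteq> a i \<odot> E i" and F: "finite F"
  shows "qnrm K (lc E (\<lambda>i. a i * c i) F) \<le> qnrm K (lc E c F)"
proof -
  have gc: "g \<in> carrier A" "adj A g \<in> carrier A" "nrm A g \<le> 1"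
    using g u v nrm_isometry_le by auto
  have "qnrm K (lc E (\<lambda>i. a i * c i) F) = qnrm K (g \<otimes> lc E c F \<otimes> adj A g)"
    using lc_conj[OF gc(1,2) E F] qnrm_cgr[OF ideal] by metis
  also have "\<dots> \<le> nrm A (adj A g) * qnrm K (g \<otimes> lc E c F)"
    using gc by (intro qnrm_mult_right[OF ideal]) auto
  also have "\<dots> \<le> qnrm K (g \<otimes> lc E c F)"
    using gc qnrm_nonneg[OF ideal, of "g \<otimes> lc E c F"]
    by (simp add: nrm_adj mult_left_le_one_le nrm_nonneg)
  also have "\<dots> \<le> nrm A g * qnrm K (lc E c F)"
    using gc by (intro qnrm_mult_left[OF ideal]) auto
  also have "\<dots> \<le> qnrm K (lc E c F)"
    using gc qnrm_nonneg[OF ideal, of "lc E c F"]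
    by (simp add: mult_left_le_one_le nrm_nonneg)
  finally show ?thesis .
qed

section \<open>Averages over conjugations by the generators\<close>

context
  fixes F :: "(int \<times> int) set" assumes F: "finite F"
begin

interpretation Q: finitary_seminorm "\<lambda>c. qnrm K (lc E c F)" F
  by (rule finitary_seminorm_lc) (auto simp: ideal F)

text \<open>Conjugation by \<open>u\<close> detects only the exponent of \<open>v\<close>, and
  conversely in \<open>rot_fst\<close>, so the exponents can be treated one after the other by
  averages in one variable.\<close>

lemma rot_snd: "qnrm K (lc E (\<lambda>i. lam powi snd i * c i) F) \<le> qnrm K (lc E c F)"
  using unitary by (intro conj_bound[of u] comm_conj comm_u_E F) auto

lemma rot_fst: "qnrm K (lc E (\<lambda>i. inverse lam powi fst i * c i) F) \<le> qnrm K (lc E c F)"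
  using unitary by (intro conj_bound[of v] comm_conj comm_v_E F) auto

lemma norm_inverse_lam: "cmod (inverse lam) = 1"
  by (simp add: norm_inverse norm_lam)

lemma inverse_lam_not_root_of_unity: "inverse lam powi (n :: int) = 1 \<Longrightarrow> n = 0"
  using lam_not_root_of_unity[of "- n"] by (simp add: power_int_minus flip: power_int_inverse)

text \<open>One average isolates the indices with first component \<open>fst i\<close>, another
  those with second component \<open>snd i\<close>; only the term at \<open>i\<close> is
  left.\<close>

lemma coefficient_bound:
  assumes i: "i \<in> F"
  shows "cmod (c i) * qnrm K (E i) \<le> qnrm K (lc E c F)"
proof -
  have "cmod (c i) * qnrm K (E i) \<le> qnrm K (c i \<odot> E i)"
  proof (cases "c i = 0")
    case False
    \<comment> \<open>\<open>qnrm_scal\<close> is only an upper bound; applied to the inverse scalar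
      it gives the reverse inequality.\<close>
    have "qnrm K (E i) \<le> cmod (inverse (c i)) * qnrm K (c i \<odot> E i)"
      using False qnrm_scal[OF ideal, of "c i \<odot> E i" "inverse (c i)"] by (simp add: scal_scal scal_one)
    then show ?thesis
      using False by (simp add: norm_divide field_simps)
  qed (simp add: qnrm_nonneg[OF ideal])
  also have "c i \<odot> E i = lc E (\<lambda>j. of_bool (snd j = snd i) * (of_bool (fst j = fst i) * c j)) F"
    unfolding lc_single[of E, OF E_closed F i, symmetric]
    by (intro lc_cong) (auto simp: prod_eq_iff)
  also have "qnrm K \<dots> \<le> qnrm K (lc E (\<lambda>j. of_bool (fst j = fst i) * c j) F)"
    by (rule Q.Q_coefficient[OF rot_snd norm_lam lam_not_root_of_unity])
  also have "\<dots> \<le> qnrm K (lc E c F)"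
    by (rule Q.Q_coefficient[OF rot_fst norm_inverse_lam inverse_lam_not_root_of_unity])
  finally show ?thesis .
qed

lemma fejer_bound:
  assumes "N > 0"
  shows "qnrm K (lc E (\<lambda>i. of_real (fejer N (snd i)) * (of_real (fejer N (fst i)) * c i)) F) \<le> qnrm K (lc E c F)"
proof -
  have "qnrm K (lc E (\<lambda>i. of_real (fejer N (snd i)) * (of_real (fejer N (fst i)) * c i)) F)
      \<le> qnrm K (lc E (\<lambda>i. of_real (fejer N (fst i)) * c i) F)"
    by (rule Q.Q_fejer[OF rot_snd norm_lam lam_not_root_of_unity assms])
  also have "\<dots> \<le> qnrm K (lc E c F)"
    by (rule Q.Q_fejer[OF rot_fst norm_inverse_lam inverse_lam_not_root_of_unity assms])
  finally show ?thesis .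
qed

end

end

section \<open>Simplicity of the quotient\<close>

context twisted_quotient
begin

definition limits :: "'a set" where
  "limits = {x \<in> carrier A. \<forall>e>0. \<exists>F c. finite F \<and> qnrm K (x \<ominus> lc E c F) < e}"

lemma limitsI:
  assumes "x \<in> carrier A" "\<And>e. e > 0 \<Longrightarrow> \<exists>F c. finite F \<and> qnrm K (x \<ominus> lc E c F) < e"
  shows "x \<in> limits"
  using assms by (auto simp: limits_def)

lemma limitsE:
  assumes "x \<in> limits" "e > 0"
  obtains F c where "finite F" "qnrm K (x \<ominus> lc E c F) < e"
  using assms by (auto simp: limits_def)

lemma limits_carrier: "x \<in> limits \<Longrightarrow> x \<in> carrier A"
  by (simp add: limits_def)

lemma qnrm_diff_triangle:
  assumes "x \<in> carrier A" "y \<in> carrier A" "z \<in> carrier A"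
  shows "qnrm K (x \<ominus> z) \<le> qnrm K (x \<ominus> y) + qnrm K (y \<ominus> z)"
  using qnrm_add[OF ideal, of "x \<ominus> y" "y \<ominus> z"] assms by (simp add: diff_add_diff)

text \<open>Closedness for the quotient seminorm, to which invariance under congruence, norm
  closedness and invariance under the generators all reduce.\<close>

lemma limits_approx:
  assumes x: "x \<in> carrier A" and "\<And>e. e > 0 \<Longrightarrow> \<exists>y\<in>limits. qnrm K (x \<ominus> y) < e"
  shows "x \<in> limits"
proof (rule limitsI[OF x])
  fix e :: real assume e: "e > 0"
  obtain y where y: "y \<in> limits" "qnrm K (x \<ominus> y) < e / 2"
    using assms(2)[of "e / 2"] e by auto
  obtain F c where F: "finite F" "qnrm K (y \<ominus> lc E c F) < e / 2"
    using limitsE[OF y(1), of "e / 2"] e by auto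
  have "qnrm K (x \<ominus> lc E c F) < e"
    using qnrm_diff_triangle[of x y "lc E c F"] x y F limits_carrier by fastforce
  then show "\<exists>F c. finite F \<and> qnrm K (x \<ominus> lc E c F) < e"
    using F by blast
qed

lemma limits_eqv: assumes "x \<in> limits" "x \<doteq> y" shows "y \<in> limits"
proof (rule limits_approx)
  show y: "y \<in> carrier A" using assms(2) by (rule cgr_carrier)
  have "y \<ominus> x \<in> K"
    using eqv_sym[OF assms(2)] by (simp add: cgr_def)
  then show "\<exists>x\<in>limits. qnrm K (y \<ominus> x) < e" if "e > 0" for e
    using assms(1) that qnrm_eq_0I[OF ideal] by (intro bexI[of _ x]) auto
qed

lemma limits_add: assumes "x \<in> limits" "y \<in> limits" shows "x \<oplus> y \<in> limits"
proof (rule limitsI)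
  have xy: "x \<in> carrier A" "y \<in> carrier A"
    using assms by (auto dest: limits_carrier)
  then show "x \<oplus> y \<in> carrier A" by simp
  fix e :: real assume e: "e > 0"
  obtain F c where F: "finite F" "qnrm K (x \<ominus> lc E c F) < e / 2"
    using limitsE[OF assms(1), of "e / 2"] e by auto
  obtain G d where G: "finite G" "qnrm K (y \<ominus> lc E d G) < e / 2"
    using limitsE[OF assms(2), of "e / 2"] e by auto
  let ?c = "\<lambda>i. if i \<in> F then c i else 0" and ?d = "\<lambda>i. if i \<in> G then d i else 0"
  have "x \<oplus> y \<ominus> lc E (\<lambda>i. ?c i + ?d i) (F \<union> G) = (x \<ominus> lc E c F) \<oplus> (y \<ominus> lc E d G)"
    using xy F(1) G(1) by (simp add: lc_add lc_extend add_diff_add)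
  then have "qnrm K (x \<oplus> y \<ominus> lc E (\<lambda>i. ?c i + ?d i) (F \<union> G)) < e"
    using qnrm_add[OF ideal, of "x \<ominus> lc E c F" "y \<ominus> lc E d G"] F(2) G(2) xy by simp
  then show "\<exists>F c. finite F \<and> qnrm K (x \<oplus> y \<ominus> lc E c F) < e"
    using F(1) G(1) by (intro exI[of _ "F \<union> G"] exI[of _ "\<lambda>i. ?c i + ?d i"] conjI finite_UnI)
qed

lemma limits_scal: assumes "x \<in> limits" shows "a \<odot> x \<in> limits"
proof (rule limitsI)
  have x: "x \<in> carrier A"
    using assms by (rule limits_carrier)
  then show "a \<odot> x \<in> carrier A" by simp
  fix e :: real assume e: "e > 0"
  obtain F c where F: "finite F" "qnrm K (x \<ominus> lc E c F) < e / (cmod a + 1)"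
    using limitsE[OF assms, of "e / (cmod a + 1)"] e by (auto simp: add_nonneg_pos)
  have "qnrm K (a \<odot> x \<ominus> lc E (\<lambda>i. a * c i) F) \<le> cmod a * qnrm K (x \<ominus> lc E c F)"
    using x F(1) qnrm_scal[OF ideal, of "x \<ominus> lc E c F" a] by (simp add: lc_scal scal_diff_right)
  also have "\<dots> \<le> cmod a * (e / (cmod a + 1))"
    using F(2) by (intro mult_left_mono) auto
  also have "\<dots> < e"
    using e add_nonneg_pos[of "cmod a" 1] by (simp add: field_simps)
  finally show "\<exists>F c. finite F \<and> qnrm K (a \<odot> x \<ominus> lc E c F) < e"
    using F(1) by blast
qed

lemma E_in_limits: "E i \<in> limits"
proof (rule limitsI)
  have "lc E (\<lambda>i. 1) {i} = E i"
    by (simp add: lc_insert lc_empty scal_one)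
  then show "\<exists>F c. finite F \<and> qnrm K (E i \<ominus> lc E c F) < e" if "e > 0" for e
    using that by (intro exI[of _ "{i}"] exI[of _ "\<lambda>i. 1"]) (simp add: minus_self qnrm_zero[OF ideal])
qed simp

lemma zero_in_limits: "\<zero> \<in> limits"
  using limits_scal[OF E_in_limits, of 0] by (simp add: scal_zero)

lemma limits_norm_closed: "norm_closed A limits"
  unfolding norm_closed_iff
proof (intro conjI ballI impI)
  fix x assume x: "x \<in> carrier A" and lim: "\<forall>e>0. \<exists>y\<in>limits. nrm A (x \<ominus> y) < e"
  show "x \<in> limits"
  proof (rule limits_approx[OF x])
    fix e :: real assume "e > 0"
    then obtain y where y: "y \<in> limits" "nrm A (x \<ominus> y) < e"
      using lim by blast
    moreover have "qnrm K (x \<ominus> y) \<le> nrm A (x \<ominus> y)"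
      using x y limits_carrier by (intro qnrm_le_nrm[OF ideal]) auto
    ultimately show "\<exists>y\<in>limits. qnrm K (x \<ominus> y) < e"
      by (intro bexI[of _ y]) auto
  qed
qed (auto dest: limits_carrier)

lemma limits_mult_gen:
  assumes x: "x \<in> limits" and g: "g \<in> {u, v, adj A u, adj A v}"
  shows "x \<otimes> g \<in> limits"
proof (rule limits_approx)
  have xc: "x \<in> carrier A" and gc: "g \<in> carrier A" and g1: "nrm A g \<le> 1"
    using x g limits_carrier u v nrm_isometry_le by (auto simp: nrm_adj)
  show "x \<otimes> g \<in> carrier A"
    using xc gc by simp
  fix e :: real assume "e > 0"
  then obtain F c where F: "finite F" "qnrm K (x \<ominus> lc E c F) < e"
    using limitsE[OF x] by auto
  have "lc E c F \<otimes> g \<in> limits"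
    using F(1)
  proof induction
    case empty
    then show ?case using gc by (simp add: lc_empty zero_in_limits)
  next
    case (insert i F)
    have "E i \<otimes> g \<in> limits"
      using E_mult_gen[OF g, of i] limits_eqv[OF limits_scal[OF E_in_limits]] eqv_sym by blast
    then show ?case
      using insert gc by (simp add: lc_insert l_distr smult_mult_left limits_add limits_scal)
  qed
  moreover have "qnrm K (x \<otimes> g \<ominus> lc E c F \<otimes> g) \<le> nrm A g * qnrm K (x \<ominus> lc E c F)"
    using xc gc qnrm_mult_right[OF ideal, of "x \<ominus> lc E c F" g] by (simp add: mult_diff_right)
  moreover have "nrm A g * qnrm K (x \<ominus> lc E c F) \<le> qnrm K (x \<ominus> lc E c F)"
    using g1 xc gc by (intro mult_left_le_one_le qnrm_nonneg[OF ideal] nrm_nonneg) auto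
  ultimately show "\<exists>y\<in>limits. qnrm K (x \<otimes> g \<ominus> y) < e"
    using F(2) by (intro bexI[of _ "lc E c F \<otimes> g"]) auto
qed

text \<open>\<open>\<one>\<close> is the monomial \<open>E (0, 0)\<close>, and \<open>limits\<close>
  is stable under right multiplication by the generators, hence by all of \<open>A\<close>.\<close>

lemma limits_eq_carrier: "limits = carrier A"
proof -
  have "\<one> \<in> limits"
    using E_in_limits[of "(0, 0)"] by (simp add: E_def ipow_def)
  then have "x \<in> limits" if "x \<in> carrier A" for x
    using that mult_right_invariant[OF limits_norm_closed limits_add limits_scal limits_mult_gen, of \<one> x]
    by simp
  then show ?thesis
    using limits_carrier by blast
qed

text \<open>Let \<open>c\<close> and \<open>d\<close> be the coefficients of the coarse and the
  finer approximation of \<open>x\<close>, and \<open>\<phi>\<close> the Fejer weights. In the split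
  of \<open>c\<close> into (1 - \<phi>) c, \<phi> (c - d) and \<phi> d, the first part is small by
  the choice of the order, the second by contractivity, and the third because \<open>x\<close> in
  \<open>L\<close> forces small coefficients \<open>d\<close>.\<close>

theorem maximal:
  assumes closed: "norm_closed A K" and L: "ideal L A" "K \<subseteq> L" "\<one> \<notin> L" "norm_closed A L"
  shows "L \<subseteq> K"
proof
  interpret L: twisted_quotient A u v lam L
    by (intro twisted_quotient.intro twisted_pair_axioms ideal_quotient.intro
        ideal_quotient_axioms.intro cstar_algebra_axioms twisted_quotient_axioms.intro)
      (use L defects in auto)
  fix x assume x: "x \<in> L"
  have xc: "x \<in> carrier A"
    using ideal.axioms(1)[OF L(1)] x by (rule additive_subgroup.a_Hcarr)
  \<comment> \<open>The monomials are left invertible modulo \<open>L\<close>, so they lie outside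
    the closed ideal \<open>L\<close>; this permits division by their seminorms.\<close>
  have qE: "qnrm L (E i) > 0" for i
    using L.E_notin[OF L(3), of i] qnrm_eq_0D[OF L(1,4), of "E i"] qnrm_nonneg[OF L(1), of "E i"]
    by (auto simp: less_le)
  \<comment> \<open>One \<open>e\<close> is the distance from \<open>x\<close> to the coarse
    combination; the three parts of the split cost \<open>e\<close>, \<open>2 * e\<close> and
    \<open>e\<close>.\<close>
  have small: "qnrm K x \<le> 5 * e" if e: "e > 0" for e
  proof -
    obtain F0 c0 where F0: "finite F0" "qnrm K (x \<ominus> lc E c0 F0) < e"
      using xc e by (auto simp: limits_eq_carrier[symmetric] elim: limitsE)
    define c where "c i = (if i \<in> F0 then c0 i else 0)" for i
    define \<phi> where "\<phi> N i = complex_of_real (fejer N (snd i)) * complex_of_real (fejer N (fst i))"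
      for N :: nat and i :: "int \<times> int"
    have "(\<lambda>N. \<Sum>i\<in>F0. cmod ((1 - \<phi> N i) * c i) * qnrm K (E i)) \<longlonglongrightarrow>
        (\<Sum>i\<in>F0. cmod ((1 - complex_of_real 1 * complex_of_real 1) * c i) * qnrm K (E i))"
      unfolding \<phi>_def by (intro tendsto_intros fejer_tendsto_1)
    then have "(\<lambda>N. \<Sum>i\<in>F0. cmod ((1 - \<phi> N i) * c i) * qnrm K (E i)) \<longlonglongrightarrow> 0"
      by simp
    then have "\<forall>\<^sub>F N in sequentially. (\<Sum>i\<in>F0. cmod ((1 - \<phi> N i) * c i) * qnrm K (E i)) < e"
      using e by (rule order_tendstoD)
    then have "\<forall>\<^sub>F N in sequentially. (\<Sum>i\<in>F0. cmod ((1 - \<phi> N i) * c i) * qnrm K (E i)) < e \<and> N > 0"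
      using eventually_gt_at_top[of 0] by (rule eventually_conj)
    then obtain N where N: "(\<Sum>i\<in>F0. cmod ((1 - \<phi> N i) * c i) * qnrm K (E i)) < e" "N > 0"
      by (auto dest: eventually_happens)
    \<comment> \<open>\<open>fejer N\<close> vanishes from distance \<open>N\<close> on, so only
      indices in this box carry weight. The box and \<open>C\<close> depend on \<open>N\<close> but
      not on the finer approximation.\<close>
    define B where "B = {- int N..int N} \<times> {- int N..int N}"
    \<comment> \<open>Coefficients are controlled through \<open>qnrm L (E i)\<close>, while their
      terms are measured by \<open>qnrm K (E i)\<close>; \<open>C\<close> adds up the conversion
      factors.\<close>
    define C where "C = (\<Sum>i\<in>B. qnrm K (E i) / qnrm L (E i))"
    have C: "0 \<le> C"
      unfolding C_def using qE by (intro sum_nonneg divide_nonneg_nonneg qnrm_nonneg[OF ideal]) (auto intro: less_imp_le)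
    \<comment> \<open>The bound \<open>e / (C + 1)\<close> is for the coefficients, with
      \<open>+ 1\<close> because \<open>C\<close> may be 0; the bound \<open>e\<close> is for the
      distance \<open>2 * e\<close> between the two combinations.\<close>
    obtain F1 c1 where F1: "finite F1" "qnrm K (x \<ominus> lc E c1 F1) < min e (e / (C + 1))"
      using xc e C limitsE[of x "min e (e / (C + 1))"] by (auto simp: limits_eq_carrier)
    define d where "d i = (if i \<in> F1 then c1 i else 0)" for i
    define F where "F = F0 \<union> F1"
    have F: "finite F" "F0 \<subseteq> F" "F1 \<subseteq> F"
      using F0 F1 by (auto simp: F_def)
    have lcc: "lc E c F = lc E c0 F0" and lcd: "lc E d F = lc E c1 F1"
      using F unfolding c_def d_def by (auto intro!: lc_extend)
    interpret Q: finitary_seminorm "\<lambda>c. qnrm K (lc E c F)" F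
      by (rule finitary_seminorm_lc) (auto simp: ideal F)
    have Q_le: "qnrm K (lc E b F) \<le> (\<Sum>i\<in>F. cmod (b i) * qnrm K (E i))" for b
    proof -
      have "qnrm K (lc E (\<lambda>j. of_bool (j = i)) F) = qnrm K (E i)" if "i \<in> F" for i
        using lc_single[of E, OF E_closed F(1) that, of "\<lambda>i. 1"] by (simp add: scal_one)
      then show ?thesis
        using Q.Q_le_sum[of b] by simp
    qed
    have "qnrm K (lc E (\<lambda>i. (1 - \<phi> N i) * c i) F) \<le> (\<Sum>i\<in>F. cmod ((1 - \<phi> N i) * c i) * qnrm K (E i))"
      by (rule Q_le)
    also have "\<dots> = (\<Sum>i\<in>F0. cmod ((1 - \<phi> N i) * c i) * qnrm K (E i))"
      using F by (intro sum.mono_neutral_right) (auto simp: c_def)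
    finally have 1: "qnrm K (lc E (\<lambda>i. (1 - \<phi> N i) * c i) F) \<le> e"
      using N by simp
    have "qnrm K (lc E (\<lambda>i. \<phi> N i * (c i + - 1 * d i)) F) \<le> qnrm K (lc E (\<lambda>i. c i + - 1 * d i) F)"
      using fejer_bound[OF F(1) N(2), of "\<lambda>i. c i + - 1 * d i"] by (simp only: \<phi>_def mult.assoc)
    also have "lc E (\<lambda>i. c i + - 1 * d i) F = lc E c F \<ominus> lc E d F"
      unfolding lc_add[of E, OF E_closed] lc_scal[of E, OF E_closed F(1)]
      by (simp add: scal_uminus_one a_minus_def)
    also have "qnrm K \<dots> \<le> qnrm K (lc E c F \<ominus> x) + qnrm K (x \<ominus> lc E d F)"
      using xc by (intro qnrm_diff_triangle) auto
    also have "qnrm K (lc E c F \<ominus> x) \<le> qnrm K (x \<ominus> lc E c F)"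
      using xc qnrm_scal[OF ideal, of "x \<ominus> lc E c F" "- 1"] by (simp add: scal_uminus_one minus_minus_swap)
    finally have 2: "qnrm K (lc E (\<lambda>i. \<phi> N i * (c i + - 1 * d i)) F) \<le> 2 * e"
      using F0 F1 by (simp add: lcc lcd)
    \<comment> \<open>\<open>x\<close> vanishes modulo \<open>L\<close> and
      \<open>K \<subseteq> L\<close>, so the finer combination is small modulo \<open>L\<close>;
      this passes to each coefficient.\<close>
    have coeff: "cmod (d i) \<le> e / (C + 1) / qnrm L (E i)" if "i \<in> F" for i
    proof -
      have "cmod (d i) * qnrm L (E i) \<le> qnrm L (lc E d F)"
        using that by (rule L.coefficient_bound[OF F(1)])
      also have "lc E d F = (lc E d F \<ominus> x) \<oplus> x"
        using xc by (simp add: diff_add_cancel)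
      also have "qnrm L \<dots> \<le> qnrm L (lc E d F \<ominus> x) + qnrm L x"
        using xc by (intro qnrm_add[OF L(1)]) auto
      also have "\<dots> = qnrm L (lc E d F \<ominus> x)"
        using x qnrm_eq_0I[OF L(1)] by simp
      also have "\<dots> \<le> qnrm L (x \<ominus> lc E d F)"
        using xc qnrm_scal[OF L(1), of "x \<ominus> lc E d F" "- 1"] by (simp add: scal_uminus_one minus_minus_swap)
      also have "\<dots> \<le> qnrm K (x \<ominus> lc E d F)"
        using xc by (intro qnrm_antimono L ideal) auto
      also have "\<dots> \<le> e / (C + 1)"
        using F1 by (simp add: lcd)
      finally show ?thesis
        using qE[of i] by (simp only: pos_le_divide_eq)
    qed
    have "qnrm K (lc E (\<lambda>i. \<phi> N i * d i) F) \<le> (\<Sum>i\<in>F. cmod (\<phi> N i * d i) * qnrm K (E i))"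
      by (rule Q_le)
    also have "\<dots> = (\<Sum>i\<in>F \<inter> B. cmod (\<phi> N i * d i) * qnrm K (E i))"
    proof (rule sum.mono_neutral_right)
      show "\<forall>i\<in>F - F \<inter> B. cmod (\<phi> N i * d i) * qnrm K (E i) = 0"
      proof
        fix i assume "i \<in> F - F \<inter> B"
        then have "int N \<le> \<bar>fst i\<bar> \<or> int N \<le> \<bar>snd i\<bar>"
          by (cases i) (auto simp: B_def)
        then have "\<phi> N i = 0"
          by (auto simp: \<phi>_def fejer_eq_0)
        then show "cmod (\<phi> N i * d i) * qnrm K (E i) = 0" by simp
      qed
    qed (use F in auto)
    also have "\<dots> \<le> (\<Sum>i\<in>F \<inter> B. e / (C + 1) / qnrm L (E i) * qnrm K (E i))"
    proof (intro sum_mono mult_right_mono qnrm_nonneg[OF ideal])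
      fix i assume i: "i \<in> F \<inter> B"
      have fej: "0 \<le> fejer N m" "fejer N m \<le> 1" for m
        using fejer_bounds(2)[OF N(2)] by (auto simp: fejer_def intro!: sum_nonneg divide_nonneg_nonneg)
      then have "cmod (\<phi> N i) \<le> 1"
        by (simp add: \<phi>_def norm_mult mult_le_one)
      then have "cmod (\<phi> N i * d i) \<le> cmod (d i)"
        by (simp add: norm_mult mult_left_le_one_le)
      then show "cmod (\<phi> N i * d i) \<le> e / (C + 1) / qnrm L (E i)"
        using coeff[of i] i by simp
    qed simp
    also have "\<dots> \<le> (\<Sum>i\<in>B. e / (C + 1) / qnrm L (E i) * qnrm K (E i))"
      using e C qE by (intro sum_mono2 mult_nonneg_nonneg divide_nonneg_nonneg qnrm_nonneg[OF ideal])
        (auto simp: B_def intro: less_imp_le)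
    also have "\<dots> = e / (C + 1) * C"
      by (simp add: C_def sum_distrib_left)
    also have "\<dots> \<le> e"
      using e C by (simp add: field_simps)
    finally have 3: "qnrm K (lc E (\<lambda>i. \<phi> N i * d i) F) \<le> e" .
    have "lc E c F = lc E (\<lambda>i. (1 - \<phi> N i) * c i + (\<phi> N i * (c i + - 1 * d i) + \<phi> N i * d i)) F"
      by (intro arg_cong[where f = "\<lambda>c. lc E c F"]) (simp add: fun_eq_iff algebra_simps)
    then have "qnrm K (lc E c F) \<le> e + (2 * e + e)"
      using Q.Q_add[of "\<lambda>i. (1 - \<phi> N i) * c i" "\<lambda>i. \<phi> N i * (c i + - 1 * d i) + \<phi> N i * d i"]
        Q.Q_add[of "\<lambda>i. \<phi> N i * (c i + - 1 * d i)" "\<lambda>i. \<phi> N i * d i"] 1 2 3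
      by simp
    moreover have "qnrm K x \<le> qnrm K (x \<ominus> lc E c F) + qnrm K (lc E c F)"
      using xc qnrm_add[OF ideal, of "x \<ominus> lc E c F" "lc E c F"] by (simp add: diff_add_cancel)
    ultimately show ?thesis
      using F0 by (simp add: lcc)
  qed
  have "qnrm K x \<le> 0"
  proof (rule field_le_epsilon)
    show "qnrm K x \<le> 0 + e" if "e > 0" for e
      using small[of "e / 5"] that by simp
  qed
  then show "x \<in> K"
    using qnrm_nonneg[OF ideal xc] by (intro qnrm_eq_0D[OF ideal closed xc]) simp
qed

end

theorem proposition3p2:
  fixes A :: "'a cstar" (structure) and u v :: 'a and \<theta> :: real
  assumes "\<theta> \<notin> \<rat>"
    and "free_twist \<theta> A u v"
  defines "J \<equiv> closed_ideal_gen A {\<one> \<ominus> u \<otimes> adj A u, \<one> \<ominus> v \<otimes> adj A v}"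
  shows "\<forall>I. closed_ideal A I \<and> I \<noteq> carrier A \<longrightarrow> I \<subseteq> J"
proof (intro allI impI)
  fix I assume I: "closed_ideal A I \<and> I \<noteq> carrier A"
  define lam where "lam = exp (2 * complex_of_real pi * \<i> * complex_of_real \<theta>)"
  have ft: "cstar_algebra A" "isometry A u" "isometry A v" "u \<otimes> v = lam \<odot> (v \<otimes> u)"
      "cstar_gen A {u, v} = carrier A"
    using assms(2) by (auto simp: free_twist_def twisted_isometries_def lam_def)
  interpret cstar_algebra A by fact
  have norm_lam: "cmod lam = 1"
    by (simp add: lam_def)
  have root: "n = 0" if "lam powi n = 1" for n :: int
  proof (rule ccontr)
    assume n: "n \<noteq> 0"
    \<comment> \<open>A relation \<open>lam powi n = 1\<close> makes \<open>n * \<theta>\<close> an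
      integer, against irrationality when \<open>n \<noteq> 0\<close>.\<close>
    have "exp (of_int n * (2 * complex_of_real pi * \<i> * complex_of_real \<theta>)) = 1"
      using that by (simp add: lam_def exp_power_int)
    then obtain m :: int where "n * (2 * pi * \<theta>) = of_int (2 * m) * pi"
      unfolding exp_eq_1 by (auto simp: mult.assoc)
    then have "\<theta> = of_int m / of_int n"
      using n by (simp add: field_simps)
    then show False
      using assms(1) by simp
  qed
  interpret twisted_pair A u v lam
    using ft norm_lam root by unfold_locales
  have gens: "{\<one> \<ominus> u \<otimes> adj A u, \<one> \<ominus> v \<otimes> adj A v} \<subseteq> carrier A"
    by auto
  have J: "ideal J A" "norm_closed A J"
    using closed_ideal_gen(1)[OF gens] by (auto simp: J_def closed_ideal_def)
  have defects: "\<one> \<ominus> u \<otimes> adj A u \<in> J" "\<one> \<ominus> v \<otimes> adj A v \<in> J"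
    using closed_ideal_gen(2)[OF gens] by (auto simp: J_def)
  interpret twisted_quotient A u v lam J
    by (intro twisted_quotient.intro twisted_pair_axioms ideal_quotient.intro
        ideal_quotient_axioms.intro cstar_algebra_axioms twisted_quotient_axioms.intro J defects)
  have I': "ideal I A" "norm_closed A I"
    using I by (auto simp: closed_ideal_def)
  \<comment> \<open>\<open>absorb I\<close> is a closed ideal containing both defects and
    \<open>J\<close> is the least such; then \<open>maximal\<close> applies with
    \<open>absorb I\<close> as the larger ideal.\<close>
  have "J \<subseteq> absorb I"
    unfolding J_def closed_ideal_gen_def
    using ideal_absorb[OF I'(1)] absorb_norm_closed[OF I'(1)] absorb_defects[OF I'(1)]
    by (auto simp: closed_ideal_def)
  then have "absorb I \<subseteq> J"
    using I I' by (intro maximal J ideal_absorb absorb_norm_closed one_notin_absorb) auto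
  then show "I \<subseteq> J"
    using subset_absorb[OF I'(1)] by simp
qed

end
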